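(* Suppose that $f(z)=\sum_{n=0}^\infty a_nz^n$ is a log-regular transcendental entire function and there exists $N_0\in\mathbb N$ such that $0<a_{n+1}\le a_n$ for all $n\ge N_0$. Let $(n_k)_{k\ge1}$ be a strictly increasing sequence of non-negative integers, and suppose that $g$ is a transcendental entire function with $$g(z)=\sum_{k=1}^\infty a_{n_k}z^{n_k},$$ where, for some $M>1$ and $\alpha>2$, $$1<\frac{n_{k+1}}{n_k}<M\quad\text{for large }k,$$ and $$n_k>k\log k\,(\log\log k)^\alpha\quad\text{for large }k.$$ Then $g$ is log-regular and $A_R(g)$ is a spider's web, where $R>0$ is such that $M(r,g)>r$ for $r\ge R$.
   Context: For an entire function $f$ put $M(r,f)=\max_{|z|=r}|f(z)|$ for $r>0$. $f^n$ is the $n$th iterate of $f$, and $M^n(R,f)$ is the $n$th iterate of the map $r\mapsto M(r,f)$ applied to $R$. $\mathbb N=\{1,2,\ldots\}$. For a transcendental entire function $f$ and $R>0$ with $M(r,f)>r$ for all $r\ge R$, define $A_R(f)=\{z\in\mathbb C: |f^n(z)|\ge M^n(R,f)\text{ for } n\in\mathbb N\}$. A set $E\subset\mathbb C$ is a spider's web if $E$ is connected and there is a sequence $(G_n)_{n\in\mathbb N}$ of bounded simply connected domains with $G_n\subset G_{n+1}$ and $\partial G_n\subset E$ for all $n\in\mathbb N$, and $\bigcup_{n\in\mathbb N}G_n=\mathbb C$. A transcendental entire function $f$ is log-regular (with constant $c>0$) if $\phi(t)=\log M(e^t,f)$ satisfies $\phi'(t)/\phi(t)\ge (1+c)/t$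 for all large $t$; it is log-regular if this holds for some $c>0$. (Since $\phi$ is convex, $\phi'$ exists outside a countable set; at exceptional points $\phi'$ is read as the right derivative.) *)

theory Defs
  imports "HOL-Complex_Analysis.Complex_Analysis" "HOL-Computational_Algebra.Polynomial"
begin

definition transcendental_entire :: "(complex \<Rightarrow> complex) \<Rightarrow> bool" where
  "transcendental_entire f \<longleftrightarrow>
     f holomorphic_on UNIV \<and> \<not> (\<exists>p :: complex poly. \<forall>z. f z = poly p z)"

(* The maximum over the circle is written as a supremum; max_modulus_attained below shows
   that it is attained for continuous f. *)
definition max_modulus :: "real \<Rightarrow> (complex \<Rightarrow> complex) \<Rightarrow> real" where
  "max_modulus r f = (SUP z\<in>sphere 0 r. norm (f z))"

lemma max_modulus_attained:
  assumes "continuous_on (sphere 0 r) f" and "r \<ge> 0"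
  shows "\<exists>z\<in>sphere 0 r. norm (f z) = max_modulus r f \<and>
           (\<forall>w\<in>sphere 0 r. norm (f w) \<le> norm (f z))"
proof -
  have "continuous_on (sphere 0 r) (\<lambda>z. norm (f z))"
    using assms(1) by (rule continuous_on_norm)
  moreover have "sphere (0::complex) r \<noteq> {}"
    using assms(2) by simp
  ultimately obtain z where z: "z \<in> sphere 0 r" "\<forall>w\<in>sphere 0 r. norm (f w) \<le> norm (f z)"
    using continuous_attains_sup[OF compact_sphere] by blast
  have "max_modulus r f = norm (f z)"
    unfolding max_modulus_def by (rule cSup_eq_maximum) (use z in auto)
  with z show ?thesis by auto
qed

definition A_set :: "real \<Rightarrow> (complex \<Rightarrow> complex) \<Rightarrow> complex set" where
  "A_set R f = {z. \<forall>n\<ge>1. norm ((f ^^ n) z) \<ge> ((\<lambda>r. max_modulus r f) ^^ n) R}"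

(* A domain is a nonempty open connected set. *)
definition spiders_web :: "complex set \<Rightarrow> bool" where
  "spiders_web E \<longleftrightarrow> connected E \<and>
     (\<exists>G :: nat \<Rightarrow> complex set.
        (\<forall>n. G n \<noteq> {} \<and> open (G n) \<and> connected (G n) \<and> simply_connected (G n) \<and> bounded (G n)) \<and>
        (\<forall>n. G n \<subseteq> G (Suc n) \<and> frontier (G n) \<subseteq> E) \<and>
        (\<Union>n. G n) = UNIV)"

definition log_max_modulus :: "(complex \<Rightarrow> complex) \<Rightarrow> real \<Rightarrow> real" where
  "log_max_modulus f t = ln (max_modulus (exp t) f)"

(* D is the right derivative of log_max_modulus f at t. By convexity it exists for all large t,
   and it is the ordinary derivative wherever the latter exists. *)
definition log_regular_with :: "real \<Rightarrow> (complex \<Rightarrow> complex) \<Rightarrow> bool" where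
  "log_regular_with c f \<longleftrightarrow> transcendental_entire f \<and>
     (\<forall>\<^sub>F t in at_top. \<exists>D. (log_max_modulus f has_real_derivative D) (at_right t) \<and>
        D / log_max_modulus f t \<ge> (1 + c) / t)"

definition log_regular :: "(complex \<Rightarrow> complex) \<Rightarrow> bool" where
  "log_regular f \<longleftrightarrow> (\<exists>c>0. log_regular_with c f)"

end

theory Submission
  imports Defs "HOL-Real_Asymp.Real_Asymp"
begin

text \<open>
  By convexity of \<open>\<phi>(t) = log M(e\<^sup>t)\<close>, log-regularity amounts to: for every \<open>A\<close> there is \<open>K > 1\<close> with
  \<open>\<phi>(K t) \<ge> A K \<phi>(t)\<close> for large \<open>t\<close>. This passes from \<open>f\<close> to \<open>g\<close>, because the monotone coefficients and the
  bounded ratios of the exponents give \<open>\<phi>\<^sub>g(t) \<le> \<phi>\<^sub>f(t) + O(1)\<close> and \<open>\<phi>\<^sub>f(t) \<le> \<phi>\<^sub>g(2 M t) + O(1)\<close>.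

  For the spider's web it is enough to find radii \<open>\<rho>\<^sub>n > M\<^sup>n(R)\<close> with \<open>|g| \<ge> \<rho>\<^sub>n\<^sub>+\<^sub>1\<close> on \<open>|z| = \<rho>\<^sub>n\<close>: they trap the
  component around \<open>0\<close> of the complement of a level set, so its filled boundary is a loop in \<open>A\<^sub>R(g)\<close>; the
  components of \<open>A\<^sub>R(g)\<close> are unbounded by the maximum principle and hence meet these loops.

  The radii come from the gaps. Put \<open>\<Phi>(t) = log (\<Sum>|a(n\<^sub>k)| e\<^sup>t\<^sup>n\<^sup>k)\<close>. Borel's growth lemma yields \<open>t\<close> with
  \<open>\<Phi>(t + \<sigma>) \<le> 2 \<Phi>(t)\<close>, where \<open>\<sigma>\<close> is about \<open>1 / (log \<Phi> (log log \<Phi>)\<^sup>1\<^sup>+\<^sup>\<epsilon>)\<close>, so near \<open>|z| = e\<^sup>t\<close> the function \<open>g\<close> is,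
  up to a bounded error, a polynomial with \<open>N\<close> terms of degree at most \<open>\<Lambda> = 4 \<Phi> / \<sigma>\<close>, and \<open>\<alpha> > 2\<close> says
  exactly that \<open>N log (\<Lambda> / N) = o(\<Phi>)\<close> can be achieved. If such a polynomial were smaller than \<open>(N / \<Lambda>)\<^sup>1\<^sup>2\<^sup>N\<close>
  times the sum of its coefficients somewhere on each of many nearby circles, then by the pigeonhole
  principle \<open>3 N\<close> of these points would lie in a tiny box; Lagrange interpolation and Schwarz's lemma make the
  polynomial small on the whole box, and Turan's lemma then makes all its coefficients too small.
\<close>


subsection \<open>Interpolation and the lemmas of Schwarz and Turan\<close>

text \<open>Zeros are divided out one at a time: at a zero the difference quotient is again entire,
  and it still vanishes at the other zeros because these are different points.\<close>

lemma factor_zeros: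
  fixes h :: "complex \<Rightarrow> complex"
  assumes "finite Z" "h holomorphic_on UNIV" "\<And>z. z \<in> Z \<Longrightarrow> h z = 0"
  shows "\<exists>u. u holomorphic_on UNIV \<and> (\<forall>z. h z = (\<Prod>w\<in>Z. z - w) * u z)"
  using assms
proof (induction Z arbitrary: h rule: finite_induct)
  case empty
  then show ?case by (auto intro!: exI[of _ h])
next
  case (insert a Z)
  define h1 where "h1 = (\<lambda>z. if z = a then deriv h a else (h z - h a) / (z - a))"
  have hol: "h1 holomorphic_on UNIV"
    unfolding h1_def using pole_lemma_open[of h UNIV a] insert.prems by simp
  have h: "h z = (z - a) * h1 z" for z
    using insert.prems(2)[of a] by (simp add: h1_def)
  have "h1 z = 0" if "z \<in> Z" for z
    using that insert.hyps insert.prems(2)[of z] insert.prems(2)[of a] by (auto simp: h1_def)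
  from insert.IH[OF hol this] obtain u where u: "u holomorphic_on UNIV" "\<forall>z. h1 z = (\<Prod>w\<in>Z. z - w) * u z"
    by blast
  show ?case
    by (rule exI[of _ u]) (use u insert.hyps h in \<open>simp add: algebra_simps\<close>)
qed

text \<open>One term of the expansion of \<open>(1 + 1 / K) ^ (N + m)\<close> is at most the whole
  sum, which is at most \<open>exp 1 ^ N\<close>.\<close>

lemma binomial_bound:
  fixes N m K :: nat
  assumes "N + m \<le> K * N" "K \<ge> 1"
  shows "real ((N + m) choose m) \<le> (3 * real K) ^ N"
proof -
  have "real ((N + m) choose N) * (1 / real K) ^ N \<le> (\<Sum>k\<le>N+m. real ((N + m) choose k) * (1 / real K) ^ k)"
    by (rule member_le_sum) auto
  also have "\<dots> = (1 + 1 / real K) ^ (N + m)"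
    using binomial_ring[of "1 / real K" 1 "N + m"] by (simp add: add.commute)
  also have "\<dots> \<le> exp (1 / real K) ^ (N + m)"
    using assms exp_ge_add_one_self[of "1 / real K"] by (intro power_mono) auto
  also have "\<dots> \<le> exp (1 / real K) ^ (K * N)"
    using assms by (intro power_increasing) auto
  also have "\<dots> = exp 1 ^ N"
    using assms by (simp add: power_mult flip: exp_of_nat_mult)
  also have "\<dots> \<le> 3 ^ N"
    using exp_le by (intro power_mono) auto
  finally have "real ((N + m) choose N) \<le> 3 ^ N * real K ^ N"
    using assms by (simp add: field_simps)
  moreover have "(N + m) choose m = (N + m) choose N"
    using binomial_symmetric[of m "N + m"] by simp
  ultimately show ?thesis by (simp add: power_mult_distrib)
qed


text \<open>Divide \<open>f - L\<close> by the product of the \<open>z - w\<close> and apply the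
  maximum principle to the quotient on the larger disc: each factor is at least \<open>R - r\<close>
  on the bounding circle and at most \<open>2 * r\<close> at \<open>\<zeta>\<close>. The gain is
  exponential in the number of nodes.\<close>

lemma schwarz_nodes:
  fixes f L :: "complex \<Rightarrow> complex"
  assumes Z: "finite Z" "Z \<subseteq> cball c r" and r: "0 \<le> r" "r < R"
    and hol: "f holomorphic_on UNIV" "L holomorphic_on UNIV"
    and eq: "\<And>z. z \<in> Z \<Longrightarrow> f z = L z"
    and bound: "\<And>z. z \<in> cball c R \<Longrightarrow> norm (f z - L z) \<le> A"
    and \<zeta>: "\<zeta> \<in> cball c r"
  shows "norm (f \<zeta> - L \<zeta>) \<le> (2 * r / (R - r)) ^ card Z * A"
proof -
  obtain u where u: "u holomorphic_on UNIV" "\<And>z. f z - L z = (\<Prod>w\<in>Z. z - w) * u z"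
    using factor_zeros[of Z "\<lambda>z. f z - L z"] Z(1) eq hol by (auto intro!: holomorphic_intros)
  have "norm (u \<zeta>) \<le> A / (R - r) ^ card Z"
  proof (rule maximum_modulus_frontier[of u "ball c R"])
    show "u holomorphic_on interior (ball c R)" "continuous_on (closure (ball c R)) u"
      using u(1) holomorphic_on_subset holomorphic_on_imp_continuous_on continuous_on_subset by blast+
    fix z assume "z \<in> frontier (ball c R)"
    then have z: "dist c z = R" using r by simp
    have "(R - r) ^ card Z = (\<Prod>w\<in>Z. R - r)" by simp
    also have "\<dots> \<le> (\<Prod>w\<in>Z. norm (z - w))"
    proof (rule prod_mono, intro conjI)
      fix w assume "w \<in> Z"
      then have "dist c w \<le> r" using Z by auto
      then show "R - r \<le> norm (z - w)"
        using z dist_triangle[of c z w] by (simp add: dist_norm norm_minus_commute)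
    qed (use r in auto)
    finally have "(R - r) ^ card Z * norm (u z) \<le> norm (f z - L z)"
      by (simp add: u(2) norm_mult prod_norm mult_right_mono)
    also have "\<dots> \<le> A" using bound z by simp
    finally show "norm (u z) \<le> A / (R - r) ^ card Z"
      using r by (simp add: field_simps)
  qed (use \<zeta> r in auto)
  moreover have "(\<Prod>w\<in>Z. norm (\<zeta> - w)) \<le> (\<Prod>w\<in>Z. 2 * r)"
  proof (rule prod_mono, intro conjI)
    fix w assume "w \<in> Z"
    then have "dist c w \<le> r" using Z by auto
    then show "norm (\<zeta> - w) \<le> 2 * r"
      using \<zeta> dist_triangle[of \<zeta> w c] by (simp add: dist_norm norm_minus_commute)
  qed auto
  ultimately have "(\<Prod>w\<in>Z. norm (\<zeta> - w)) * norm (u \<zeta>) \<le> (2 * r) ^ card Z * (A / (R - r) ^ card Z)"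
    using r by (intro mult_mono) auto
  then show ?thesis
    by (simp add: u(2) norm_mult prod_norm power_divide)
qed

lemma fact_le_prod:
  assumes "finite S" "0 \<notin> S"
  shows "fact (card S) \<le> \<Prod>(S :: nat set)"
  using assms
proof (induction "card S" arbitrary: S)
  case 0
  then show ?case by simp
next
  case (Suc n)
  then have "S \<noteq> {}" by auto
  define M where "M = Max S"
  have M: "M \<in> S" using Suc \<open>S \<noteq> {}\<close> by (simp add: M_def)
  have "S \<subseteq> {1..M}"
    using Suc.prems by (auto simp: M_def Suc_le_eq intro!: Nat.gr0I)
  then have "card S \<le> M"
    using card_mono[of "{1..M}" S] by simp
  moreover have "card (S - {M}) = n"
    using Suc.hyps(2) M Suc.prems by simp
  then have "fact n \<le> \<Prod>(S - {M})"
    using Suc.hyps(1)[of "S - {M}"] Suc.prems by simp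
  moreover have "\<Prod>S = M * \<Prod>(S - {M})"
    using M Suc.prems by (simp add: prod.remove)
  moreover have "fact (card S) = card S * fact n"
    by (simp only: Suc.hyps(2)[symmetric] fact_Suc of_nat_id)
  ultimately show ?case
    by (simp only: mult_le_mono)
qed

text \<open>The distances from \<open>v\<close> to the elements on one side are distinct positive
  integers. With \<open>a\<close> elements below and \<open>b\<close> above, the product is
  therefore at least a! b!, that is (a + b)! divided by a binomial coefficient, which is at most
  2^(a + b).\<close>

lemma prod_distances_ge:
  fixes V :: "nat set"
  assumes "finite V" "v \<in> V"
  shows "fact (card V - 1) / 2 ^ (card V - 1) \<le> (\<Prod>w\<in>V - {v}. \<bar>real v - real w\<bar>)"
proof -
  define A where "A = {w\<in>V. w < v}"
  define B where "B = {w\<in>V. v < w}"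
  have fin: "finite A" "finite B" using assms by (auto simp: A_def B_def)
  have V: "V - {v} = A \<union> B" "A \<inter> B = {}" by (auto simp: A_def B_def)
  have card: "card V - 1 = card A + card B"
    using card_Diff_singleton[OF assms(2)] card_Un_disjoint[OF fin V(2)] V(1) by simp
  have "(\<Prod>w\<in>A. \<bar>real v - real w\<bar>) = (\<Prod>w\<in>A. real (v - w))"
    by (rule prod.cong) (auto simp: A_def)
  also have "\<dots> = real (\<Prod>((\<lambda>w. v - w) ` A))"
    by (subst prod.reindex) (auto simp: A_def inj_on_def)
  also have "\<dots> \<ge> real (fact (card ((\<lambda>w. v - w) ` A)))"
    by (subst of_nat_le_iff, rule fact_le_prod) (use fin in \<open>auto simp: A_def\<close>)
  also have "card ((\<lambda>w. v - w) ` A) = card A"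
    by (rule card_image) (auto simp: A_def inj_on_def)
  finally have A: "fact (card A) \<le> (\<Prod>w\<in>A. \<bar>real v - real w\<bar>)" by simp
  have "(\<Prod>w\<in>B. \<bar>real v - real w\<bar>) = (\<Prod>w\<in>B. real (w - v))"
    by (rule prod.cong) (auto simp: B_def)
  also have "\<dots> = real (\<Prod>((\<lambda>w. w - v) ` B))"
    by (subst prod.reindex) (auto simp: B_def inj_on_def)
  also have "\<dots> \<ge> real (fact (card ((\<lambda>w. w - v) ` B)))"
    by (subst of_nat_le_iff, rule fact_le_prod) (use fin in \<open>auto simp: B_def\<close>)
  also have "card ((\<lambda>w. w - v) ` B) = card B"
    by (rule card_image) (auto simp: B_def inj_on_def)
  finally have B: "fact (card B) \<le> (\<Prod>w\<in>B. \<bar>real v - real w\<bar>)" by simp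
  have "real (fact (card A) * fact (card B) * ((card A + card B) choose card A)) = real (fact (card A + card B))"
    using binomial_fact_lemma[of "card A" "card A + card B"] by simp
  then have "fact (card A + card B) = fact (card A) * fact (card B) * real ((card A + card B) choose card A)"
    by (simp only: of_nat_mult of_nat_fact)
  also have "\<dots> \<le> fact (card A) * fact (card B) * 2 ^ (card A + card B)"
  proof (intro mult_left_mono)
    show "real ((card A + card B) choose card A) \<le> 2 ^ (card A + card B)"
      using of_nat_mono[OF binomial_le_pow2[of "card A + card B" "card A"], where 'a=real] by simp
  qed auto
  finally have "fact (card V - 1) / 2 ^ (card V - 1) \<le> (fact (card A) * fact (card B) :: real)"
    unfolding card by (subst pos_divide_le_eq) simp_all
  also have "\<dots> \<le> (\<Prod>w\<in>A. \<bar>real v - real w\<bar>) * (\<Prod>w\<in>B. \<bar>real v - real w\<bar>)"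
    using A B by (intro mult_mono) (auto intro!: prod_nonneg)
  also have "\<dots> = (\<Prod>w\<in>V - {v}. \<bar>real v - real w\<bar>)"
    unfolding V(1) by (rule prod.union_disjoint[OF fin V(2), symmetric])
  finally show ?thesis .
qed

section \<open>Turan's lemma for exponential sums\<close>

lemma coeff_mult_linear_bound:
  fixes p :: "complex poly"
  assumes "\<And>i. norm (coeff p i) \<le> A" "norm e = 1"
  shows "norm (coeff (p * [:1, - e:]) i) \<le> 2 * A"
proof -
  have "coeff (p * [:1, - e:]) i = coeff p i - e * coeff (pCons 0 p) i"
    by (cases i) (simp_all add: algebra_simps)
  then have "norm (coeff (p * [:1, - e:]) i) \<le> norm (coeff p i) + norm (coeff (pCons 0 p) i)"
    using norm_triangle_ineq4[of "coeff p i" "e * coeff (pCons 0 p) i"] assms by (simp add: norm_mult)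
  also have "norm (coeff (pCons 0 p) i) \<le> A"
    using assms(1)[of 0] assms(1)[of "i - 1"] order_trans[OF norm_ge_zero assms(1)[of 0]]
    by (cases i) auto
  finally show ?thesis using assms(1)[of i] by simp
qed

text \<open>The inverse of each factor is a geometric series with unimodular coefficients. The
  binomial is the coefficient of the power -(card I + 1) of 1 - X: counting one factor more avoids a
  subtraction and makes the induction step a hockey-stick sum.\<close>

lemma fps_inverse_prod_bound:
  fixes e :: "'i \<Rightarrow> complex"
  assumes "finite I" "\<And>i. i \<in> I \<Longrightarrow> norm (e i) = 1"
  shows "\<exists>H. fps_of_poly (\<Prod>i\<in>I. [:1, - e i:]) * H = 1 \<and>
             (\<forall>k. norm (fps_nth H k) \<le> real ((card I + k) choose k))"
  using assms
proof (induction I rule: finite_induct)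
  case empty
  then show ?case by (auto intro!: exI[of _ 1])
next
  case (insert j I)
  then obtain H where H: "fps_of_poly (\<Prod>i\<in>I. [:1, - e i:]) * H = 1"
     "\<And>k. norm (fps_nth H k) \<le> real ((card I + k) choose k)" by auto
  define G where "G = Abs_fps (\<lambda>k. e j ^ k)"
  have G: "fps_of_poly [:1, - e j:] * G = 1"
  proof (rule fps_ext)
    fix k
    show "fps_nth (fps_of_poly [:1, - e j:] * G) k = fps_nth 1 k"
      by (cases k) (simp_all add: fps_of_poly_pCons G_def algebra_simps mult.assoc)
  qed
  have ej: "norm (e j) = 1" using insert.prems by simp
  have "fps_of_poly (\<Prod>i\<in>insert j I. [:1, - e i:]) * (H * G)
        = (fps_of_poly (\<Prod>i\<in>I. [:1, - e i:]) * H) * (fps_of_poly [:1, - e j:] * G)"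
    by (simp only: prod.insert[OF insert.hyps] fps_of_poly_mult mult_ac)
  then have "fps_of_poly (\<Prod>i\<in>insert j I. [:1, - e i:]) * (H * G) = 1" using H G by simp
  moreover have "norm (fps_nth (H * G) k) \<le> real ((card (insert j I) + k) choose k)" for k
  proof -
    have "norm (fps_nth (H * G) k) \<le> (\<Sum>i=0..k. norm (fps_nth H i * fps_nth G (k - i)))"
      unfolding fps_mult_nth by (rule norm_sum)
    also have "\<dots> \<le> (\<Sum>i=0..k. real ((card I + i) choose i))"
      by (rule sum_mono) (simp add: G_def norm_mult norm_power ej H(2))
    also have "\<dots> = real (Suc (card I + k) choose k)"
      using sum_choose_lower[of "card I" k] by (simp add: atLeast0AtMost flip: of_nat_sum)
    finally show ?thesis using insert.hyps by simp
  qed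
  ultimately show ?case by blast
qed

lemma choose_diag_mono: "k \<le> m \<Longrightarrow> (n + k) choose k \<le> (n + m) choose m"
proof (induction m rule: nat_induct_at_least)
  case base then show ?case by simp
next
  case (Suc m)
  then show ?case by simp
qed

text \<open>The polynomial \<open>D\<close> in the proof is \<open>E = \<Prod>(1 - X / c\<^sub>i)\<close> times the truncation of \<open>1 / E\<close> at degree \<open>m\<close>: it
  vanishes at the \<open>c\<^sub>i\<close>, has constant term \<open>1\<close>, and no terms of degree \<open>1, \<dots>, m\<close>.\<close>

lemma turan_functional:
  fixes c :: "'i \<Rightarrow> complex"
  assumes I: "finite I" and c: "\<And>i. i \<in> I \<Longrightarrow> norm (c i) = 1"
  shows "\<exists>d :: nat \<Rightarrow> complex. (\<forall>i\<in>I. (\<Sum>v\<in>{m+1..m+card I}. d v * c i ^ v) = 1) \<and>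
           (\<forall>v. norm (d v) \<le> 2 ^ card I * real ((card I + m) choose m))"
proof -
  define e where "e i = inverse (c i)" for i
  have e: "norm (e i) = 1" if "i \<in> I" for i using c that by (simp add: e_def norm_inverse)
  define E where "E = (\<Prod>i\<in>I. [:1, - e i:])"
  obtain H where H: "fps_of_poly E * H = 1" "\<And>k. norm (fps_nth H k) \<le> real ((card I + k) choose k)"
    using fps_inverse_prod_bound[of I e] I e unfolding E_def by blast
  define T where "T = (\<Sum>k\<le>m. monom (fps_nth H k) k)"
  have coeffT: "coeff T k = (if k \<le> m then fps_nth H k else 0)" for k
    by (simp add: T_def coeff_sum sum.delta')
  define D where "D = T * E"
  have degE: "degree E \<le> card I"
  proof -
    have "degree E \<le> sum (degree \<circ> (\<lambda>i. [:1, - e i:])) I"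
      unfolding E_def by (rule degree_prod_sum_le[OF I])
    also have "\<dots> \<le> (\<Sum>i\<in>I. 1)" by (rule sum_mono) simp
    finally show ?thesis by simp
  qed
  have degT: "degree T \<le> m"
    by (rule degree_le) (simp add: coeffT)
  have degD: "degree D \<le> m + card I"
    unfolding D_def using degree_mult_le[of T E] degE degT by linarith
  have low: "coeff D k = (if k = 0 then 1 else 0)" if "k \<le> m" for k
  proof -
    have "coeff D k = (\<Sum>i\<le>k. coeff T i * coeff E (k - i))"
      by (simp add: D_def coeff_mult)
    also have "\<dots> = (\<Sum>i\<le>k. fps_nth H i * coeff E (k - i))"
      by (rule sum.cong) (use that in \<open>auto simp: coeffT\<close>)
    also have "\<dots> = fps_nth (H * fps_of_poly E) k"
      by (simp add: fps_mult_nth atLeast0AtMost)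
    finally show ?thesis using H(1) by (simp add: mult.commute)
  qed
  have bT: "norm (coeff T k) \<le> real ((card I + m) choose m)" for k
  proof (cases "k \<le> m")
    case True
    have "(card I + k) choose k \<le> (card I + m) choose m"
      by (rule choose_diag_mono[OF True])
    then have "real ((card I + k) choose k) \<le> real ((card I + m) choose m)" by simp
    then show ?thesis using True H(2)[of k] by (simp add: coeffT)
  qed (simp add: coeffT)
  have bD: "norm (coeff D k) \<le> 2 ^ card I * real ((card I + m) choose m)" for k
  proof -
    have "norm (coeff (T * (\<Prod>i\<in>J. [:1, - e i:])) k) \<le> 2 ^ card J * real ((card I + m) choose m)"
      if "finite J" "J \<subseteq> I" for J k
      using that
    proof (induction J arbitrary: k rule: finite_induct)
      case empty then show ?case by (simp add: bT)
    next
      case (insert j J)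
      have "T * (\<Prod>i\<in>insert j J. [:1, - e i:]) = (T * (\<Prod>i\<in>J. [:1, - e i:])) * [:1, - e j:]"
        by (simp only: prod.insert[OF insert.hyps] mult_ac)
      moreover have "norm (coeff ((T * (\<Prod>i\<in>J. [:1, - e i:])) * [:1, - e j:]) k) \<le> 2 * (2 ^ card J * real ((card I + m) choose m))"
        by (rule coeff_mult_linear_bound) (use insert e in auto)
      ultimately show ?case using insert.hyps by simp
    qed
    then show ?thesis using I by (simp add: D_def E_def)
  qed
  \<comment> \<open>\<open>D\<close> vanishes at \<open>c i\<close> and has no terms of degree 1,
    ..., m, so its constant term 1 is balanced by the terms of degree above \<open>m\<close>
    alone.\<close>
  have "(\<Sum>v\<in>{m+1..m+card I}. - coeff D v * c i ^ v) = 1" if i: "i \<in> I" for i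
  proof -
    have "c i \<noteq> 0" using c[OF i] by auto
    then have "\<exists>k\<in>I. poly [:1, - e k:] (c i) = 0"
      using i by (intro bexI[of _ i]) (simp_all add: e_def)
    then have "poly E (c i) = 0"
      unfolding E_def poly_prod by (rule prod_zero[OF I])
    then have "0 = poly D (c i)" by (simp add: D_def)
    also have "\<dots> = (\<Sum>k\<le>m + card I. coeff D k * c i ^ k)"
    proof -
      have "(\<Sum>k\<le>m + card I. coeff D k * c i ^ k) = (\<Sum>k\<le>degree D. coeff D k * c i ^ k)"
        by (rule sum.mono_neutral_right) (use degD in \<open>auto simp: coeff_eq_0\<close>)
      then show ?thesis by (simp add: poly_altdef)
    qed
    also have "{..m + card I} = {..m} \<union> {m+1..m+card I}" by auto
    also have "(\<Sum>k\<in>{..m} \<union> {m+1..m+card I}. coeff D k * c i ^ k)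
       = (\<Sum>k\<le>m. coeff D k * c i ^ k) + (\<Sum>k\<in>{m+1..m+card I}. coeff D k * c i ^ k)"
      by (rule sum.union_disjoint) auto
    also have "(\<Sum>k\<le>m. coeff D k * c i ^ k) = (\<Sum>k\<le>m. if k = 0 then 1 else 0)"
      by (rule sum.cong) (auto simp: low)
    also have "(\<Sum>k\<le>m. if k = 0 then 1 else (0::complex)) = 1" by simp
    finally have "(\<Sum>k\<in>{m+1..m+card I}. coeff D k * c i ^ k) = -1"
      by (simp only: eq_neg_iff_add_eq_0 add.commute)
    then show ?thesis by (simp only: minus_mult_left[symmetric] sum_negf) simp
  qed
  then show ?thesis using bD by (intro exI[of _ "\<lambda>v. - coeff D v"]) (simp del: One_nat_def)
qed

text \<open>A polynomial with exponents \<open>l i\<close>, written in the logarithmic coordinate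
  exp z: circles about 0 become vertical lines on which the function has period 2 pi, and nearby
  circles fill a thin strip.\<close>

definition exp_sum :: "'i set \<Rightarrow> ('i \<Rightarrow> complex) \<Rightarrow> ('i \<Rightarrow> nat) \<Rightarrow> complex \<Rightarrow> complex" where
  "exp_sum I b l z = (\<Sum>i\<in>I. b i * exp (of_nat (l i) * z))"

lemma holomorphic_exp_sum: "exp_sum I b l holomorphic_on S"
  unfolding exp_sum_def by (intro holomorphic_intros)

lemma norm_exp_sum_le:
  assumes "finite I" "\<And>i. i \<in> I \<Longrightarrow> real (l i) * Re z \<le> c"
  shows "norm (exp_sum I b l z) \<le> exp c * (\<Sum>i\<in>I. norm (b i))"
proof -
  have "norm (exp_sum I b l z) \<le> (\<Sum>i\<in>I. norm (b i) * exp c)"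
    unfolding exp_sum_def
    by (rule sum_norm_le) (use assms in \<open>auto simp: norm_mult intro!: mult_left_mono\<close>)
  then show ?thesis by (simp add: sum_distrib_left mult.commute)
qed

lemma exp_sum_periodic: "exp_sum I b l (z + 2 * pi * of_int k * \<i>) = exp_sum I b l z"
proof -
  have "exp (of_nat m * (z + 2 * pi * of_int k * \<i>)) = exp (of_nat m * z)" for m
  proof -
    have "of_nat m * (z + 2 * pi * of_int k * \<i>) = of_nat m * z + of_int (2 * (int m * k)) * of_real pi * \<i>"
      by (simp add: algebra_simps)
    then show ?thesis by (auto simp: exp_eq intro!: exI[of _ "int m * k"])
  qed
  then show ?thesis by (simp add: exp_sum_def)
qed

text \<open>A discrete form of Cauchy's coefficient formula: averaging over \<open>n\<close> equally
  spaced points of a period isolates the coefficient as soon as \<open>n\<close> exceeds all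
  exponents.\<close>

lemma exp_sum_coeff_bound:
  assumes I: "finite I" and inj: "inj_on l I" and j: "j \<in> I"
    and X: "\<And>\<theta>. c \<le> \<theta> \<Longrightarrow> \<theta> < c + 2 * pi \<Longrightarrow> norm (exp_sum I b l (\<i> * of_real \<theta>)) \<le> X"
  shows "norm (b j) \<le> X"
proof -
  define n where "n = Suc (Max (l ` I))"
  have n: "l i < n" if "i \<in> I" for i using that I by (simp add: n_def le_imp_less_Suc)
  have n0: "n > 0" by (simp add: n_def)
  define t where "t v = c + 2 * pi * real v / real n" for v
  define \<xi> where "\<xi> i = exp (2 * pi * \<i> * (of_nat (l i) - of_nat (l j)) / of_nat n)" for i
  have \<xi>n: "\<xi> i ^ n = 1" for i
  proof -
    have "\<xi> i ^ n = exp (2 * pi * \<i> * (of_nat (l i) - of_nat (l j)))"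
      using n0 by (simp add: \<xi>_def flip: exp_of_nat_mult)
    also have "\<dots> = exp (of_real (2 * pi * of_int (int (l i) - int (l j))) * \<i>)"
      by (simp add: algebra_simps)
    also have "\<dots> = 1"
      by (subst exp_eq_1) (auto intro!: exI[of _ "int (l i) - int (l j)"])
    finally show ?thesis .
  qed
  \<comment> \<open>Distinct exponents differ by less than \<open>n\<close>, so \<open>n\<close>
    does not divide their difference; the geometric sum over the root of unity
    \<open>\<xi> i\<close> then vanishes.\<close>
  have \<xi>1: "\<xi> i \<noteq> 1" if i: "i \<in> I" "i \<noteq> j" for i
  proof
    assume "\<xi> i = 1"
    moreover have "\<xi> i = exp (of_real (2 * pi * (real (l i) - real (l j)) / real n) * \<i>)"
      by (simp add: \<xi>_def algebra_simps)
    ultimately obtain k :: int where "2 * pi * (real (l i) - real (l j)) / real n = of_int (2 * k) * pi"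
      by (auto simp: exp_eq_1)
    then have "pi * (2 * (real (l i) - real (l j))) = pi * (2 * (of_int k * real n))"
      using n0 by (simp add: field_simps)
    then have "real (l i) - real (l j) = of_int k * real n" by simp
    then have "of_int (int (l i) - int (l j)) = (of_int (k * int n) :: real)" by simp
    then have k: "int (l i) - int (l j) = k * int n" using of_int_eq_iff by blast
    have "\<bar>int (l i) - int (l j)\<bar> < int n" using n[OF i(1)] n[OF j] by linarith
    then have "\<bar>k\<bar> * int n < 1 * int n" using k by (simp add: abs_mult)
    then have "\<bar>k\<bar> < 1" by (rule mult_right_less_imp_less) simp
    then have "k = 0" by simp
    then have "l i = l j" using k by simp
    then show False using inj i j by (auto dest: inj_onD)
  qed
  have "(\<Sum>v<n. exp_sum I b l (\<i> * of_real (t v)) * exp (- of_nat (l j) * (\<i> * of_real (t v))))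
      = (\<Sum>v<n. \<Sum>i\<in>I. b i * exp (\<i> * c * (of_nat (l i) - of_nat (l j))) * \<xi> i ^ v)"
  proof (rule sum.cong[OF refl])
    fix v
    have "exp (of_nat (l i) * (\<i> * of_real (t v))) * exp (- of_nat (l j) * (\<i> * of_real (t v)))
       = exp (\<i> * c * (of_nat (l i) - of_nat (l j))) * \<xi> i ^ v" for i
      unfolding \<xi>_def t_def exp_of_nat_mult[symmetric] exp_add[symmetric]
      by (rule arg_cong[of _ _ exp]) (simp add: algebra_simps diff_divide_distrib)
    then show "exp_sum I b l (\<i> * of_real (t v)) * exp (- of_nat (l j) * (\<i> * of_real (t v)))
      = (\<Sum>i\<in>I. b i * exp (\<i> * c * (of_nat (l i) - of_nat (l j))) * \<xi> i ^ v)"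
      unfolding exp_sum_def sum_distrib_right by (intro sum.cong) (auto simp: mult.assoc)
  qed
  also have "\<dots> = (\<Sum>i\<in>I. b i * exp (\<i> * c * (of_nat (l i) - of_nat (l j))) * (\<Sum>v<n. \<xi> i ^ v))"
    by (subst sum.swap) (simp add: sum_distrib_left)
  also have "\<dots> = (\<Sum>i\<in>I. if i = j then b j * of_nat n else 0)"
  proof (rule sum.cong[OF refl])
    fix i assume i: "i \<in> I"
    show "b i * exp (\<i> * c * (of_nat (l i) - of_nat (l j))) * (\<Sum>v<n. \<xi> i ^ v) = (if i = j then b j * of_nat n else 0)"
    proof (cases "i = j")
      case True
      then have "\<xi> i = 1" by (simp add: \<xi>_def)
      then show ?thesis using True by simp
    next
      case False
      have "(\<Sum>v<n. \<xi> i ^ v) = 0"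
        by (simp only: geometric_sum[OF \<xi>1[OF i False]] \<xi>n) simp
      then show ?thesis using False by simp
    qed
  qed
  also have "\<dots> = b j * of_nat n" using I j by simp
  finally have "real n * norm (b j) = norm (\<Sum>v<n. exp_sum I b l (\<i> * of_real (t v)) * exp (- of_nat (l j) * (\<i> * of_real (t v))))"
    by (simp add: norm_mult)
  also have "\<dots> \<le> (\<Sum>v<n. X)"
  proof (rule sum_norm_le)
    fix v assume "v \<in> {..<n}"
    then have "c \<le> t v" "t v < c + 2 * pi" using n0 by (auto simp: t_def field_simps)
    then show "norm (exp_sum I b l (\<i> * of_real (t v)) * exp (- of_nat (l j) * (\<i> * of_real (t v)))) \<le> X"
      using X by (simp add: norm_mult)
  qed
  finally show ?thesis using n0 by simp
qed

text \<open>Turan's lemma: a short arc controls a full period, at a cost exponential in the number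
  of terms but independent of the exponents. By \<open>turan_functional\<close> the value at
  \<open>t\<close> is a combination of the values at \<open>n\<close> equally spaced points of the
  arc.\<close>

lemma turan_arc:
  assumes I: "finite I" "I \<noteq> {}" "card I \<le> N" and q: "q \<ge> (1::nat)"
    and X: "\<And>\<theta>. a \<le> \<theta> \<Longrightarrow> \<theta> \<le> a + 1 / real q ^ 2 \<Longrightarrow> norm (exp_sum I b l (\<i> * of_real \<theta>)) \<le> X"
    and t: "a - 2 * pi \<le> t" "t < a"
  shows "norm (exp_sum I b l (\<i> * of_real t)) \<le> (96 * real q ^ 2) ^ N * X"
proof -
  define n where "n = card I"
  have n: "n \<ge> 1" "n \<le> N" using I by (auto simp: n_def Suc_le_eq card_gt_0_iff)
  \<comment> \<open>With this spacing \<open>n\<close> steps have the length of the arc. As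
    \<open>m\<close> is the number of steps that fit between \<open>t\<close> and \<open>a\<close>,
    the points number m + 1, ..., m + n lie on the arc.\<close>
  define s where "s = 1 / (q\<^sup>2 * real n)"
  have s: "s > 0" using q n by (simp add: s_def)
  define m where "m = nat \<lfloor>(a - t) / s\<rfloor>"
  have "(a - t) / s \<ge> 0" using t s by simp
  then have m: "real m \<le> (a - t) / s" "(a - t) / s < real m + 1" by (auto simp: m_def)
  then have m': "m * s \<le> a - t" "a - t < (m + 1) * s" using s by (simp_all add: field_simps)
  define w where "w i = exp (\<i> * of_real (real (l i) * s))" for i
  obtain d where d: "\<And>i. i \<in> I \<Longrightarrow> (\<Sum>v\<in>{m+1..m+n}. d v * w i ^ v) = 1"
     "\<And>v. norm (d v) \<le> 2 ^ n * real ((n + m) choose m)"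
    using turan_functional[of I w m] I(1) unfolding n_def w_def by auto
  have X0: "X \<ge> 0"
    by (rule order_trans[OF norm_ge_zero X[of a]]) auto
  have "exp_sum I b l (\<i> * of_real t) = (\<Sum>i\<in>I. \<Sum>v\<in>{m+1..m+n}. d v * (b i * (exp (of_nat (l i) * (\<i> * of_real t)) * w i ^ v)))"
    unfolding exp_sum_def
  proof (rule sum.cong[OF refl])
    fix i assume "i \<in> I"
    have "b i * exp (of_nat (l i) * (\<i> * of_real t)) = b i * exp (of_nat (l i) * (\<i> * of_real t)) * (\<Sum>v\<in>{m+1..m+n}. d v * w i ^ v)"
      using d(1)[OF \<open>i \<in> I\<close>] by simp
    then show "b i * exp (of_nat (l i) * (\<i> * of_real t)) = (\<Sum>v\<in>{m+1..m+n}. d v * (b i * (exp (of_nat (l i) * (\<i> * of_real t)) * w i ^ v)))"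
      by (simp add: sum_distrib_left mult_ac)
  qed
  also have "\<dots> = (\<Sum>v\<in>{m+1..m+n}. d v * exp_sum I b l (\<i> * of_real (t + v * s)))"
  proof (subst sum.swap, rule sum.cong[OF refl])
    fix v
    have "exp (of_nat (l i) * (\<i> * of_real t)) * w i ^ v = exp (of_nat (l i) * (\<i> * of_real (t + v * s)))" for i
      unfolding w_def exp_of_nat_mult[symmetric] exp_add[symmetric]
      by (rule arg_cong[of _ _ exp]) (simp add: algebra_simps)
    then show "(\<Sum>i\<in>I. d v * (b i * (exp (of_nat (l i) * (\<i> * of_real t)) * w i ^ v))) = d v * exp_sum I b l (\<i> * of_real (t + v * s))"
      by (simp add: exp_sum_def sum_distrib_left)
  qed
  finally have "norm (exp_sum I b l (\<i> * of_real t)) = norm (\<Sum>v\<in>{m+1..m+n}. d v * exp_sum I b l (\<i> * of_real (t + v * s)))"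
    by simp
  also have "\<dots> \<le> (\<Sum>v\<in>{m+1..m+n}. 2 ^ n * real ((n + m) choose m) * X)"
  proof (rule sum_norm_le)
    fix v assume v: "v \<in> {m+1..m+n}"
    have "real m + 1 \<le> real v" "real v \<le> real m + real n" using v by auto
    then have "(m + 1) * s \<le> v * s" "v * s \<le> (m + n) * s"
      using s by (auto intro!: mult_right_mono)
    moreover have "n * s = 1 / real q ^ 2" using n by (simp add: s_def)
    ultimately have "a \<le> t + v * s" "t + v * s \<le> a + 1 / real q ^ 2" using m' by (auto simp: algebra_simps)
    then show "norm (d v * exp_sum I b l (\<i> * of_real (t + v * s))) \<le> 2 ^ n * real ((n + m) choose m) * X"
      unfolding norm_mult using d(2)[of v] X[of "t + v * s"] by (intro mult_mono) auto
  qed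
  also have "\<dots> = real n * (2 ^ n * real ((n + m) choose m) * X)" by simp
  \<comment> \<open>Since 2 pi < 7, \<open>m\<close> is at most 7 q^2 n and \<open>n + m\<close> at
    most 8 q^2 n, so \<open>binomial_bound\<close> gives the 24 = 3 * 8. The other factors are
    \<open>n \<le> 2 ^ n\<close> and the \<open>2 ^ n\<close> of \<open>turan_functional\<close>;
    together they make 96 = 2 * 2 * 24.\<close>
  also have "\<dots> \<le> 2 ^ n * (2 ^ n * (24 * real q ^ 2) ^ n * X)"
  proof -
    have "(a - t) / s \<le> 7 * (q\<^sup>2 * real n)"
    proof -
      have "(a - t) * (q\<^sup>2 * real n) \<le> 7 * (q\<^sup>2 * real n)"
        using t pi_less_4 pi_approx by (intro mult_right_mono) auto
      then show ?thesis by (simp add: s_def)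
    qed
    then have "real m \<le> real (7 * q\<^sup>2 * n)" using m by simp
    then have "m \<le> 7 * q\<^sup>2 * n" by (simp only: of_nat_le_iff)
    moreover have "1 * n \<le> q\<^sup>2 * n" using q by (intro mult_le_mono1) (simp add: Suc_le_eq)
    ultimately have "n + m \<le> (8 * q\<^sup>2) * n" by (simp only: mult.assoc mult_1)
    then have "real ((n + m) choose m) \<le> (3 * real (8 * q\<^sup>2)) ^ n"
      by (rule binomial_bound) (use q in simp)
    then have C: "real ((n + m) choose m) \<le> (24 * real q ^ 2) ^ n" by simp
    have n2: "real n \<le> 2 ^ n"
      using of_nat_less_two_power[of n, where 'a=real] by linarith
    have "2 ^ n * real ((n + m) choose m) * X \<le> 2 ^ n * (24 * real q ^ 2) ^ n * X"
      by (rule mult_right_mono[OF mult_left_mono[OF C] X0]) simp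
    then show ?thesis
      by (rule mult_mono[OF n2]) (use X0 in simp_all)
  qed
  also have "\<dots> = (2 * (2 * (24 * real q ^ 2))) ^ n * X"
    by (simp only: power_mult_distrib mult_ac)
  also have "\<dots> = (96 * real q ^ 2) ^ n * X" by simp
  also have "\<dots> \<le> (96 * real q ^ 2) ^ N * X"
  proof (rule mult_right_mono[OF power_increasing[OF n(2)] X0])
    have "1 * 1 \<le> 96 * real q ^ 2" using q by (intro mult_mono) auto
    then show "1 \<le> 96 * real q ^ 2" by simp
  qed
  finally show ?thesis .
qed

lemma turan_coefficients:
  assumes I: "finite I" "card I \<le> N" and inj: "inj_on l I" and q: "q \<ge> (1::nat)"
    and X: "\<And>\<theta>. a \<le> \<theta> \<Longrightarrow> \<theta> \<le> a + 1 / real q ^ 2 \<Longrightarrow> norm (exp_sum I b l (\<i> * of_real \<theta>)) \<le> X"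
  shows "(\<Sum>i\<in>I. norm (b i)) \<le> (192 * real q ^ 2) ^ N * X"
proof -
  have X0: "X \<ge> 0"
    by (rule order_trans[OF norm_ge_zero X[of a]]) auto
  have "(\<Sum>i\<in>I. norm (b i)) \<le> (\<Sum>i\<in>I. (96 * real q ^ 2) ^ N * X)"
  proof (rule sum_mono)
    fix j assume j: "j \<in> I"
    show "norm (b j) \<le> (96 * real q ^ 2) ^ N * X"
      by (rule exp_sum_coeff_bound[of I l j "a - 2 * pi"], fact, fact, fact, rule turan_arc[of I N q a b l X])
         (use I q X j in auto)
  qed
  also have "\<dots> = real (card I) * ((96 * real q ^ 2) ^ N * X)" by simp
  also have "\<dots> \<le> 2 ^ N * ((96 * real q ^ 2) ^ N * X)"
  proof (rule mult_right_mono)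
    have "real (card I) \<le> real N" using I by simp
    then show "real (card I) \<le> 2 ^ N" using of_nat_less_two_power[of N, where 'a=real] by linarith
  qed (use X0 in auto)
  also have "\<dots> = (2 * (96 * real q ^ 2)) ^ N * X"
    by (simp only: power_mult_distrib mult_ac)
  also have "\<dots> = (192 * real q ^ 2) ^ N * X" by simp
  finally show ?thesis .
qed

subsection \<open>Minimum modulus of gap polynomials\<close>

lemma card_fibre_pigeonhole:
  fixes h :: "nat \<Rightarrow> nat"
  assumes "\<And>v. v < m * p \<Longrightarrow> h v < m" "m > 0" "p > 0"
  shows "\<exists>j<m. \<exists>V \<subseteq> {..<m * p}. card V = p \<and> (\<forall>v\<in>V. h v = j)"
proof -
  have "\<exists>j<m. p \<le> card {v\<in>{..<m * p}. h v = j}"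
  proof (rule ccontr)
    assume "\<not> ?thesis"
    then have small: "card {v\<in>{..<m * p}. h v = j} \<le> p - 1" if "j < m" for j
      using that by force
    have "{..<m * p} = (\<Union>j<m. {v\<in>{..<m * p}. h v = j})" using assms by auto
    then have "m * p = card (\<Union>j<m. {v\<in>{..<m * p}. h v = j})" by (metis card_lessThan)
    also have "\<dots> \<le> (\<Sum>j<m. card {v\<in>{..<m * p}. h v = j})"
      by (rule card_UN_le) simp
    also have "\<dots> \<le> (\<Sum>j<m. p - 1)" by (rule sum_mono) (use small in auto)
    also have "\<dots> = m * (p - 1)" by simp
    also have "\<dots> < m * p" using assms by simp
    finally show False by simp
  qed
  then obtain j where j: "j < m" "p \<le> card {v\<in>{..<m * p}. h v = j}" by blast
  obtain V where "V \<subseteq> {v\<in>{..<m * p}. h v = j}" "card V = p"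
    using obtain_subset_with_card_n[OF j(2)] by metis
  then show ?thesis using j(1) by blast
qed

text \<open>A term of the exponential series at \<open>n + 1\<close>. It absorbs the power of the
  number of nodes that a node spacing proportional to 1 / N puts into Lagrange's formula.\<close>

lemma power_le_exp_fact: "real (n + 1) ^ n \<le> 3 ^ (n + 1) * fact n"
proof -
  have "real (n + 1) ^ n / fact n \<le> exp (real (n + 1))"
    using sum_le_suminf[of "\<lambda>k. real (n + 1) ^ k /\<^sub>R fact k" "{n}"] summable_exp_generic[of "real (n + 1)"]
    by (simp add: exp_def divide_inverse mult.commute)
  also have "\<dots> = exp 1 ^ (n + 1)"
    by (simp only: exp_of_nat_mult[symmetric] mult_1_right)
  also have "\<dots> \<le> 3 ^ (n + 1)" by (intro power_mono exp_le) simp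
  finally show ?thesis by (simp add: divide_le_eq)
qed

text \<open>Because the separation grows with the difference of the indices,
  \<open>prod_distances_ge\<close> bounds the denominators below by h^n n! / 2^n; the minimal
  spacing alone would give only h^n.\<close>

lemma lagrange_nodes_bound:
  fixes \<zeta> :: "nat \<Rightarrow> complex" and f :: "complex \<Rightarrow> complex"
  assumes V: "finite V" "card V = n + 1" and h: "h > 0" and D: "D \<ge> 0"
    and sep: "\<And>v w. v \<in> V \<Longrightarrow> w \<in> V \<Longrightarrow> h * \<bar>real v - real w\<bar> \<le> norm (\<zeta> v - \<zeta> w)"
    and f: "\<And>v. v \<in> V \<Longrightarrow> norm (f (\<zeta> v)) \<le> \<epsilon>"
    and z: "\<And>v. v \<in> V \<Longrightarrow> norm (z - \<zeta> v) \<le> D"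
  shows "norm (\<Sum>v\<in>V. f (\<zeta> v) * (\<Prod>w\<in>V - {v}. (z - \<zeta> w) / (\<zeta> v - \<zeta> w)))
           \<le> real (n + 1) * \<epsilon> * (2 * D / h) ^ n / fact n"
proof -
  obtain v0 where "v0 \<in> V" using V by (metis all_not_in_conv card.empty Suc_eq_plus1 nat.distinct(1))
  then have \<epsilon>: "\<epsilon> \<ge> 0" using f norm_ge_zero order_trans by blast
  have "norm (\<Sum>v\<in>V. f (\<zeta> v) * (\<Prod>w\<in>V - {v}. (z - \<zeta> w) / (\<zeta> v - \<zeta> w)))
        \<le> (\<Sum>v\<in>V. \<epsilon> * ((2 * D / h) ^ n / fact n))"
  proof (rule sum_norm_le)
    fix v assume v: "v \<in> V"
    then have cV: "card (V - {v}) = n" "card V - 1 = n" using V by auto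
    have num: "(\<Prod>w\<in>V - {v}. norm (z - \<zeta> w)) \<le> D ^ n"
      using prod_mono[of "V - {v}" "\<lambda>w. norm (z - \<zeta> w)" "\<lambda>_. D"] z cV by simp
    have "h ^ n * (fact n / 2 ^ n) \<le> h ^ n * (\<Prod>w\<in>V - {v}. \<bar>real v - real w\<bar>)"
      using prod_distances_ge[OF V(1) v] h unfolding cV by (intro mult_left_mono) auto
    also have "\<dots> = (\<Prod>w\<in>V - {v}. h * \<bar>real v - real w\<bar>)"
      using cV by (simp add: prod.distrib)
    also have "\<dots> \<le> (\<Prod>w\<in>V - {v}. norm (\<zeta> v - \<zeta> w))"
      by (rule prod_mono) (use sep v h in auto)
    finally have den: "h ^ n * (fact n / 2 ^ n) \<le> (\<Prod>w\<in>V - {v}. norm (\<zeta> v - \<zeta> w))" .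
    have "norm (\<Prod>w\<in>V - {v}. (z - \<zeta> w) / (\<zeta> v - \<zeta> w))
        = (\<Prod>w\<in>V - {v}. norm (z - \<zeta> w)) / (\<Prod>w\<in>V - {v}. norm (\<zeta> v - \<zeta> w))"
      by (simp add: prod_norm[symmetric] norm_divide prod_dividef)
    also have "\<dots> \<le> D ^ n / (h ^ n * (fact n / 2 ^ n))"
      by (rule frac_le) (use num den D h in auto)
    also have "\<dots> = (2 * D / h) ^ n / fact n"
      using h by (simp add: power_mult_distrib power_divide)
    finally show "norm (f (\<zeta> v) * (\<Prod>w\<in>V - {v}. (z - \<zeta> w) / (\<zeta> v - \<zeta> w))) \<le> \<epsilon> * ((2 * D / h) ^ n / fact n)"
      unfolding norm_mult using f[OF v] \<epsilon> by (intro mult_mono) auto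
  qed
  also have "\<dots> = real (n + 1) * \<epsilon> * (2 * D / h) ^ n / fact n" using V by simp
  finally show ?thesis .
qed

lemma lagrange_at_node:
  assumes "finite V" "inj_on \<zeta> V" "u \<in> V"
  shows "(\<Sum>v\<in>V. f (\<zeta> v) * (\<Prod>w\<in>V - {v}. (\<zeta> u - \<zeta> w) / (\<zeta> v - \<zeta> w))) = (f (\<zeta> u) :: complex)"
proof -
  have "(\<Sum>v\<in>V. f (\<zeta> v) * (\<Prod>w\<in>V - {v}. (\<zeta> u - \<zeta> w) / (\<zeta> v - \<zeta> w))) = (\<Sum>v\<in>V. if v = u then f (\<zeta> u) else 0)"
  proof (rule sum.cong[OF refl])
    fix v assume v: "v \<in> V"
    show "f (\<zeta> v) * (\<Prod>w\<in>V - {v}. (\<zeta> u - \<zeta> w) / (\<zeta> v - \<zeta> w)) = (if v = u then f (\<zeta> u) else 0)"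
    proof (cases "v = u")
      case True
      have "(\<Prod>w\<in>V - {v}. (\<zeta> u - \<zeta> w) / (\<zeta> v - \<zeta> w)) = (\<Prod>w\<in>V - {v}. 1)"
        by (rule prod.cong) (use True assms v in \<open>auto dest: inj_onD\<close>)
      then show ?thesis using True by simp
    next
      case False
      then have "(\<Prod>w\<in>V - {v}. (\<zeta> u - \<zeta> w) / (\<zeta> v - \<zeta> w)) = 0"
        using assms by (intro prod_zero) auto
      then show ?thesis using False by simp
    qed
  qed
  also have "\<dots> = f (\<zeta> u)" using assms by simp
  finally show ?thesis .
qed

text \<open>Let \<open>L\<close> interpolate the sum at the \<open>3 * N\<close> nodes. Then
  \<open>L\<close> is as small as \<open>\<epsilon>\<close> up to a factor of order q^(9 N), and the
  remainder is small by \<open>schwarz_nodes\<close>. With \<open>3 * N\<close> nodes its gain q^(-3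
  N) outweighs the loss q^(2 N) in \<open>turan_coefficients\<close>.\<close>

lemma small_on_box:
  fixes \<theta> :: "nat \<Rightarrow> real"
  assumes I: "finite I" and N: "N \<ge> 1" and q: "q \<ge> (8::nat)" and l: "\<And>i. i \<in> I \<Longrightarrow> l i \<le> N * q"
    and V: "V \<subseteq> {..<7 * q\<^sup>2 * (3 * N)}" "card V = 3 * N"
    and \<theta>: "\<And>v. v \<in> V \<Longrightarrow> a \<le> \<theta> v \<and> \<theta> v \<le> a + 1 / real q ^ 2"
    and small: "\<And>v. v \<in> V \<Longrightarrow> norm (exp_sum I b l (Complex (real v / (real q ^ 2 * (7 * real q ^ 2 * (3 * real N)))) (\<theta> v))) \<le> \<epsilon>"
    and t: "a \<le> t" "t \<le> a + 1 / real q ^ 2"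
  shows "norm (exp_sum I b l (\<i> * of_real t)) \<le>
     (8 / q) ^ (3 * N) * 3 ^ N * (\<Sum>i\<in>I. norm (b i)) + 2 * \<epsilon> * (168 * real q ^ 3) ^ (3 * N)"
proof -
  define p where "p = exp_sum I b l"
  define B where "B = (\<Sum>i\<in>I. norm (b i))"
  define h where "h = 1 / (real q ^ 2 * (7 * real q ^ 2 * (3 * real N)))"
  define \<zeta> where "\<zeta> v = Complex (real v / (real q ^ 2 * (7 * real q ^ 2 * (3 * real N)))) (\<theta> v)" for v :: nat
  \<comment> \<open>The nodes lie in a box of side 1 / q^2 with corner \<open>c\<close>, hence in
    the disc of radius \<open>r\<close>. The radius \<open>R\<close> is 1 / q because exponents up
    to \<open>N * q\<close> then contribute at most the factor \<open>exp N\<close>.\<close>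
  define c where "c = Complex 0 a"
  define r where "r = 2 / real q ^ 2"
  define R where "R = 1 / real q"
  define n where "n = 3 * N - 1"
  have n: "3 * N = n + 1" using N by (simp add: n_def)
  have h: "h > 0" using q N by (simp add: h_def)
  have r: "r \<ge> 0" by (simp add: r_def)
  have rR: "4 * r \<le> R" using q by (simp add: r_def R_def power2_eq_square field_simps)
  have R: "R > 0" using q by (simp add: R_def)
  have finV: "finite V" using V finite_subset by blast
  have \<zeta>h: "\<zeta> v = Complex (h * real v) (\<theta> v)" for v by (simp add: \<zeta>_def h_def)
  have p\<zeta>: "norm (p (\<zeta> v)) \<le> \<epsilon>" if "v \<in> V" for v
    using small[OF that] by (simp add: p_def \<zeta>_def)
  have "V \<noteq> {}" using V(2) N by auto
  then obtain v0 where "v0 \<in> V" by blast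
  then have \<epsilon>: "\<epsilon> \<ge> 0" using p\<zeta> norm_ge_zero order_trans by blast
  have sep: "h * \<bar>real v - real w\<bar> \<le> norm (\<zeta> v - \<zeta> w)" for v w
    using abs_Re_le_cmod[of "\<zeta> v - \<zeta> w"] h
    by (simp add: \<zeta>h right_diff_distrib[symmetric] abs_mult)
  have inj: "inj_on \<zeta> V"
    using h by (intro inj_onI) (auto simp: \<zeta>h)
  have near: "dist c (\<zeta> v) \<le> r" if v: "v \<in> V" for v
  proof -
    have "v \<le> 7 * q\<^sup>2 * (3 * N)" using v V(1) by auto
    then have "real v \<le> real (7 * q\<^sup>2 * (3 * N))" by (simp only: of_nat_le_iff)
    then have "h * real v \<le> h * real (7 * q\<^sup>2 * (3 * N))"
      by (rule mult_left_mono) (use h in simp)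
    also have "\<dots> = 1 / real q ^ 2" using q N by (simp add: h_def)
    finally have 1: "\<bar>h * real v\<bar> \<le> 1 / real q ^ 2" using h by simp
    have 2: "\<bar>\<theta> v - a\<bar> \<le> 1 / real q ^ 2" using \<theta>[OF v] by auto
    have "norm (\<zeta> v - c) \<le> \<bar>Re (\<zeta> v - c)\<bar> + \<bar>Im (\<zeta> v - c)\<bar>" by (rule cmod_le)
    also have "\<dots> \<le> r" using 1 2 by (simp add: \<zeta>h c_def r_def)
    finally show ?thesis by (simp add: dist_norm norm_minus_commute)
  qed
  define L where "L z = (\<Sum>v\<in>V. p (\<zeta> v) * (\<Prod>w\<in>V - {v}. (z - \<zeta> w) / (\<zeta> v - \<zeta> w)))" for z
  have L_node: "L (\<zeta> v) = p (\<zeta> v)" if "v \<in> V" for v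
    unfolding L_def by (rule lagrange_at_node[OF finV inj that])
  have holL: "L holomorphic_on UNIV"
    unfolding L_def by (intro holomorphic_intros) (use inj in \<open>auto dest: inj_onD\<close>)
  \<comment> \<open>168 = 2 * 28 * 3: the distance bound 2 / q and the spacing \<open>h\<close> give
    28 q^3 (n + 1) in Lagrange's formula, while \<open>n + 1 \<le> 2 ^ (n + 1)\<close> and
    \<open>power_le_exp_fact\<close> supply the 2 and the 3.\<close>
  define Y where "Y = \<epsilon> * (168 * real q ^ 3) ^ (3 * N)"
  have Lb: "norm (L z) \<le> Y" if z: "z \<in> cball c R" for z
  proof -
    have "norm (L z) \<le> real (n + 1) * \<epsilon> * (2 * (2 / real q) / h) ^ n / fact n"
      unfolding L_def
    proof (rule lagrange_nodes_bound[OF finV _ h])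
      show "card V = n + 1" using V n by simp
      show "h * \<bar>real v - real w\<bar> \<le> norm (\<zeta> v - \<zeta> w)" for v w by (rule sep)
      show "norm (p (\<zeta> v)) \<le> \<epsilon>" if "v \<in> V" for v by (rule p\<zeta>[OF that])
      fix v assume "v \<in> V"
      then have "dist z (\<zeta> v) \<le> R + r"
        using near[of v] z dist_triangle[of z "\<zeta> v" c] by (simp add: dist_commute)
      also have "\<dots> \<le> 2 / real q" using rR r by (simp add: R_def)
      finally show "norm (z - \<zeta> v) \<le> 2 / real q" by (simp add: dist_norm)
    qed auto
    also have "2 * (2 / real q) / h = 28 * real q ^ 3 * real (n + 1)"
    proof -
      have "3 * real N = real (n + 1)" using n by linarith
      then show ?thesis using q N by (simp add: h_def power2_eq_square power3_eq_cube)
    qed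
    also have "real (n + 1) * \<epsilon> * (28 * real q ^ 3 * real (n + 1)) ^ n / fact n
        = real (n + 1) * \<epsilon> * (28 * real q ^ 3) ^ n * (real (n + 1) ^ n / fact n)"
      by (simp only: power_mult_distrib) simp
    also have "\<dots> \<le> 2 ^ (n + 1) * \<epsilon> * (28 * real q ^ 3) ^ (n + 1) * 3 ^ (n + 1)"
    proof (intro mult_mono)
      show "real (n + 1) \<le> 2 ^ (n + 1)"
        using of_nat_less_two_power[of "n + 1", where 'a=real] by linarith
      have "1 \<le> real q ^ 3" using q by (intro one_le_power) simp
      then show "(28 * real q ^ 3) ^ n \<le> (28 * real q ^ 3) ^ (n + 1)"
        by (intro power_increasing) auto
      show "real (n + 1) ^ n / fact n \<le> 3 ^ (n + 1)"
        using power_le_exp_fact[of n] by (simp add: divide_le_eq)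
    qed (use \<epsilon> in auto)
    also have "\<dots> = \<epsilon> * (2 * (28 * real q ^ 3) * 3) ^ (n + 1)"
      by (simp only: power_mult_distrib mult_ac)
    also have "\<dots> = Y" by (simp add: Y_def n)
    finally show ?thesis .
  qed
  have pb: "norm (p z) \<le> 3 ^ N * B" if z: "z \<in> cball c R" for z
  proof -
    have "norm (p z) \<le> exp (real N) * B"
      unfolding p_def B_def
    proof (rule norm_exp_sum_le[OF I])
      fix i assume i: "i \<in> I"
      have "Re z \<le> R" using z complex_Re_le_cmod[of "z - c"] by (simp add: c_def dist_norm norm_minus_commute)
      then have "real (l i) * Re z \<le> real (l i) * R" by (intro mult_left_mono) auto
      also have "\<dots> \<le> real (N * q) * R"
        using l[OF i] R by (intro mult_right_mono) (auto simp only: of_nat_le_iff)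
      also have "\<dots> = real N" using q by (simp add: R_def)
      finally show "real (l i) * Re z \<le> real N" .
    qed
    also have "\<dots> \<le> 3 ^ N * B"
    proof (rule mult_right_mono)
      show "exp (real N) \<le> 3 ^ N"
        using power_mono[OF exp_le, of N] exp_of_nat_mult[of N "1::real"] by simp
    qed (simp add: B_def sum_nonneg)
    finally show ?thesis .
  qed
  define t' where "t' = \<i> * of_real t"
  have t': "t' \<in> cball c r"
  proof -
    have "t' - c = \<i> * of_real (t - a)" by (simp add: t'_def c_def complex_eq_iff)
    then have "norm (t' - c) = \<bar>t - a\<bar>" by (simp only: norm_mult norm_ii norm_of_real) simp
    also have "\<dots> \<le> 1 / real q ^ 2" using t by auto
    also have "\<dots> \<le> r" by (simp add: r_def divide_right_mono)
    finally show ?thesis by (simp add: dist_norm norm_minus_commute)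
  qed
  have "norm (p t' - L t') \<le> (2 * r / (R - r)) ^ card (\<zeta> ` V) * (3 ^ N * B + Y)"
  proof (rule schwarz_nodes[where f = p and L = L and c = c and R = R, OF _ _ r])
    show "norm (p z - L z) \<le> 3 ^ N * B + Y" if "z \<in> cball c R" for z
      using norm_triangle_ineq4[of "p z" "L z"] pb[OF that] Lb[OF that] by linarith
    show "r < R" using rR r R by linarith
  qed (use finV near L_node holL t' in \<open>auto simp: p_def holomorphic_exp_sum\<close>)
  also have "card (\<zeta> ` V) = 3 * N" using card_image[OF inj] V by simp
  also have "(2 * r / (R - r)) ^ (3 * N) * (3 ^ N * B + Y) \<le> (8 / q) ^ (3 * N) * (3 ^ N * B + Y)"
  proof (intro mult_right_mono power_mono)
    have "2 * r / (R - r) \<le> 2 * r / (R / 2)"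
      using rR r R by (intro divide_left_mono) auto
    also have "\<dots> = 8 / q" using q by (simp add: r_def R_def power2_eq_square)
    finally show "2 * r / (R - r) \<le> 8 / q" .
    show "0 \<le> 2 * r / (R - r)" using rR r by simp
    show "0 \<le> 3 ^ N * B + Y" using \<epsilon> by (auto simp: B_def Y_def intro!: add_nonneg_nonneg mult_nonneg_nonneg sum_nonneg)
  qed
  also have "\<dots> \<le> (8 / q) ^ (3 * N) * 3 ^ N * B + Y"
  proof -
    have "(8 / real q) ^ (3 * N) * Y \<le> 1 * Y"
      using q \<epsilon> by (intro mult_right_mono power_le_one) (auto simp: Y_def)
    then show ?thesis by (simp add: algebra_simps)
  qed
  finally have "norm (p t' - L t') \<le> (8 / q) ^ (3 * N) * 3 ^ N * B + Y" .
  moreover have "norm (L t') \<le> Y"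
    using t' rR r R by (intro Lb) auto
  ultimately have "norm (p t') \<le> (8 / q) ^ (3 * N) * 3 ^ N * B + 2 * Y"
    using norm_triangle_sub[of "p t'" "L t'"] by linarith
  then show ?thesis by (simp add: p_def t'_def B_def Y_def)
qed

text \<open>If every line of the strip had a bad point, take 7 q^2 * 3 N of them. Their angles
  modulo 2 pi < 7 fall into 7 q^2 arcs of length 1 / q^2, so \<open>3 * N\<close> bad points share a
  box. In the exponent \<open>12 * N\<close>, interpolation costs 9 N, Turan's lemma 2 N, and the
  last N beats the constants: 4000000000 exceeds 4 * 910393344, where 910393344 = 192 *
  168^3.\<close>

lemma gap_sum_min_modulus:
  assumes I: "finite I" "card I \<le> N" and N: "N \<ge> 1" and inj: "inj_on l I"
    and q: "q \<ge> (4000000000::nat)" and l: "\<And>i. i \<in> I \<Longrightarrow> l i \<le> N * q"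
  shows "\<exists>s. 0 \<le> s \<and> s \<le> 1 / real q ^ 2 \<and>
     (\<forall>\<theta>. (\<Sum>i\<in>I. norm (b i)) / real q ^ (12 * N) \<le> norm (exp_sum I b l (Complex s \<theta>)))"
proof (rule ccontr)
  assume contra: "\<not> ?thesis"
  define B where "B = (\<Sum>i\<in>I. norm (b i))"
  define \<epsilon> where "\<epsilon> = B / real q ^ (12 * N)"
  define K where "K = 7 * q\<^sup>2 * (3 * N)"
  define s where "s v = real v / (real q ^ 2 * (7 * real q ^ 2 * (3 * real N)))" for v :: nat
  have K: "K > 0" using q N by (simp add: K_def)
  have s01: "0 \<le> s v" "s v \<le> 1 / real q ^ 2" if "v < K" for v
  proof -
    have "s v = (real v / real K) * (1 / real q ^ 2)" by (simp add: s_def K_def)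
    moreover have "real v / real K \<le> 1" using that by simp
    ultimately show "s v \<le> 1 / real q ^ 2"
      using mult_right_mono[of "real v / real K" 1 "1 / real q ^ 2"] by simp
  qed (simp add: s_def)
  have "\<exists>\<theta>. 0 \<le> \<theta> \<and> \<theta> < 2 * pi \<and> norm (exp_sum I b l (Complex (s v) \<theta>)) \<le> \<epsilon>" if v: "v < K" for v
  proof -
    obtain \<theta> where \<theta>: "norm (exp_sum I b l (Complex (s v) \<theta>)) < \<epsilon>"
      using contra s01[OF v] unfolding \<epsilon>_def B_def by (meson not_le)
    define k where "k = \<lfloor>\<theta> / (2 * pi)\<rfloor>"
    have "of_int k \<le> \<theta> / (2 * pi)" "\<theta> / (2 * pi) < of_int k + 1"
      by (simp_all add: k_def)
    then have "0 \<le> \<theta> - 2 * pi * k" "\<theta> - 2 * pi * k < 2 * pi"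
      by (simp_all add: field_simps)
    moreover have "Complex (s v) \<theta> = Complex (s v) (\<theta> - 2 * pi * k) + 2 * pi * of_int k * \<i>"
      by (simp add: complex_eq_iff)
    then have "exp_sum I b l (Complex (s v) \<theta>) = exp_sum I b l (Complex (s v) (\<theta> - 2 * pi * k))"
      by (simp only: exp_sum_periodic)
    ultimately show ?thesis using \<theta> by (intro exI[of _ "\<theta> - 2 * pi * k"]) auto
  qed
  then obtain \<theta> where \<theta>: "\<And>v. v < K \<Longrightarrow> 0 \<le> \<theta> v \<and> \<theta> v < 2 * pi \<and> norm (exp_sum I b l (Complex (s v) (\<theta> v))) \<le> \<epsilon>"
    by metis
  define bin where "bin v = nat \<lfloor>\<theta> v * real q ^ 2\<rfloor>" for v
  have bin: "real (bin v) \<le> \<theta> v * real q ^ 2 \<and> \<theta> v * real q ^ 2 < real (bin v) + 1" if "v < K" for v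
    using \<theta>[OF that] by (auto simp: bin_def)
  have "bin v < 7 * q\<^sup>2" if v: "v < K" for v
  proof -
    have "real (bin v) \<le> \<theta> v * real q ^ 2" using bin[OF v] by simp
    also have "\<dots> < 7 * real q ^ 2"
      using \<theta>[OF v] pi_approx q by (intro mult_strict_right_mono) auto
    finally have "real (bin v) < real (7 * q\<^sup>2)" by simp
    then show ?thesis by (simp only: of_nat_less_iff)
  qed
  then obtain j V where V: "V \<subseteq> {..<K}" "card V = 3 * N" "\<And>v. v \<in> V \<Longrightarrow> bin v = j"
    using card_fibre_pigeonhole[of "7 * q\<^sup>2" "3 * N" bin] q N unfolding K_def by auto
  define a where "a = real j / real q ^ 2"
  have arc: "a \<le> \<theta> v \<and> \<theta> v \<le> a + 1 / real q ^ 2" if v: "v \<in> V" for v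
  proof -
    have "real j \<le> \<theta> v * real q ^ 2" "\<theta> v * real q ^ 2 \<le> real j + 1"
      using bin[of v] V v by auto
    then show ?thesis using q by (simp add: a_def field_simps)
  qed
  define X where "X = (8 / q) ^ (3 * N) * 3 ^ N * B + 2 * \<epsilon> * (168 * real q ^ 3) ^ (3 * N)"
  have "norm (exp_sum I b l (\<i> * of_real t)) \<le> X" if "a \<le> t" "t \<le> a + 1 / real q ^ 2" for t
    unfolding X_def B_def
  proof (rule small_on_box[OF I(1) N _ l _ V(2) arc _ that])
    show "norm (exp_sum I b l (Complex (real v / (real q ^ 2 * (7 * real q ^ 2 * (3 * real N)))) (\<theta> v))) \<le> \<epsilon>" if "v \<in> V" for v
      using \<theta>[of v] V that by (auto simp: s_def)
  qed (use q V K_def in auto)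
  from turan_coefficients[OF I inj _ this] q have "B \<le> (192 * real q ^ 2) ^ N * X"
    by (simp add: B_def)
  also have "\<dots> = (192 * real q ^ 2 * ((8 / q) ^ 3 * 3)) ^ N * B + 2 * \<epsilon> * (192 * real q ^ 2 * (168 * real q ^ 3) ^ 3) ^ N"
    unfolding X_def power_mult_distrib[of _ _ N] power_mult by (simp only: distrib_left mult_ac)
  also have "\<dots> = (294912 / q) ^ N * B + 2 * \<epsilon> * (192 * real q ^ 2 * (168 * real q ^ 3) ^ 3) ^ N"
    using q by (simp add: power2_eq_square power3_eq_cube)
  finally have B_le: "B \<le> (294912 / q) ^ N * B + 2 * \<epsilon> * (192 * real q ^ 2 * (168 * real q ^ 3) ^ 3) ^ N" .
  have B0: "B \<ge> 0" by (simp add: B_def sum_nonneg)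
  have small1: "(294912 / q) ^ N \<le> (1 / 4) ^ 1"
  proof -
    have "(294912 / real q) ^ N \<le> (1 / 4) ^ N"
      using q by (intro power_mono) (auto simp: field_simps)
    also have "\<dots> \<le> (1 / 4) ^ 1"
      using N by (intro power_decreasing) auto
    finally show ?thesis .
  qed
  have small2: "2 * \<epsilon> * (192 * real q ^ 2 * (168 * real q ^ 3) ^ 3) ^ N \<le> B / 2"
  proof -
    have "192 * real q ^ 2 * (168 * real q ^ 3) ^ 3 = 192 * 168 ^ 3 * (real q ^ 2 * (real q ^ 3) ^ 3)"
      by (simp only: power_mult_distrib mult_ac)
    also have "real q ^ 2 * (real q ^ 3) ^ 3 = real q ^ 11"
      by (simp only: power_mult[symmetric] power_add[symmetric]) simp
    also have "192 * 168 ^ 3 * real q ^ 11 = 910393344 / real q * (real q * real q ^ 11)"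
      using q by simp
    also have "real q * real q ^ 11 = real q ^ 12"
      by (simp only: power_Suc[symmetric]) simp
    finally have "(192 * real q ^ 2 * (168 * real q ^ 3) ^ 3) ^ N = (910393344 / real q) ^ N * (real q ^ 12) ^ N"
      by (simp only: power_mult_distrib)
    also have "\<dots> \<le> (1 / 4) ^ N * (real q ^ 12) ^ N"
      using q by (intro mult_right_mono power_mono) (auto simp: field_simps)
    also have "\<dots> \<le> (1 / 4) ^ 1 * (real q ^ 12) ^ N"
      using N by (intro mult_right_mono power_decreasing) auto
    finally have "(192 * real q ^ 2 * (168 * real q ^ 3) ^ 3) ^ N \<le> real q ^ (12 * N) / 4"
      by (simp add: power_mult)
    then have "2 * \<epsilon> * (192 * real q ^ 2 * (168 * real q ^ 3) ^ 3) ^ N \<le> 2 * \<epsilon> * (real q ^ (12 * N) / 4)"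
      using B0 by (intro mult_left_mono) (auto simp: \<epsilon>_def)
    also have "\<dots> = B / 2" using q by (simp add: \<epsilon>_def)
    finally show ?thesis .
  qed
  \<comment> \<open>What remains is B \<le> B / 4 + B / 2. For \<open>B = 0\<close> the asserted
    lower bound is 0 and s = 0 satisfies it.\<close>
  have "B = 0"
    using B_le small2 mult_right_mono[OF small1 B0] B0 by simp
  then have "(\<Sum>i\<in>I. norm (b i)) / real q ^ (12 * N) = 0" by (simp add: B_def)
  with contra show False by (auto intro!: exI[of _ 0])
qed

subsection \<open>Minimum modulus of gap series\<close>

text \<open>Borel's growth lemma: a step of length \<open>G (ln x) - G (ln x + ln 2)\<close> at which the value \<open>x\<close> more than
  doubles uses up at least that much of the decreasing potential \<open>G (ln x)\<close>.\<close>

lemma borel_growth: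
  fixes \<Phi> G :: "real \<Rightarrow> real"
  assumes mono: "mono \<Phi>"
    and T: "\<Phi> T \<ge> exp y0"
    and G_antimono: "\<And>y y'. y0 \<le> y \<Longrightarrow> y \<le> y' \<Longrightarrow> G y' \<le> G y"
    and G_nonneg: "\<And>y. y0 \<le> y \<Longrightarrow> 0 \<le> G y" and G_le: "G y0 \<le> 1"
  shows "\<exists>t. T \<le> t \<and> t \<le> T + 1 \<and> \<Phi> (t + (G (ln (\<Phi> t)) - G (ln (\<Phi> t) + ln 2))) \<le> 2 * \<Phi> t"
proof (rule ccontr)
  assume contra: "\<not> ?thesis"
  define \<sigma> where "\<sigma> t = G (ln (\<Phi> t)) - G (ln (\<Phi> t) + ln 2)" for t
  define s where "s j = ((\<lambda>t. t + \<sigma> t) ^^ j) T" for j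
  have s_Suc: "s (Suc j) = s j + \<sigma> (s j)" and s_0: "s 0 = T" for j
    by (simp_all add: s_def)
  have pos: "\<Phi> T > 0" using T exp_gt_zero[of y0] by linarith
  \<comment> \<open>The invariant of the walk: the distance covered is paid for by the drop of
    \<open>G\<close>, so it never exceeds \<open>G y0 \<le> 1\<close>, while \<open>\<Phi>\<close>
    doubles at every step. Eventually \<open>\<Phi> (T + 1)\<close> is exceeded.\<close>
  have *: "T \<le> s j \<and> s j \<le> T + G y0 - G (ln (\<Phi> (s j))) \<and> 2 ^ j * \<Phi> T \<le> \<Phi> (s j)" for j
  proof (induction j)
    case 0
    have "y0 \<le> ln (\<Phi> T)" using T pos by (simp add: ln_ge_iff)
    then show ?case using G_antimono[of y0 "ln (\<Phi> T)"] by (simp add: s_0)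
  next
    case (Suc j)
    then have IH: "T \<le> s j" "s j \<le> T + G y0 - G (ln (\<Phi> (s j)))" "2 ^ j * \<Phi> T \<le> \<Phi> (s j)" by auto
    have "1 * \<Phi> T \<le> 2 ^ j * \<Phi> T" using pos by (intro mult_right_mono) auto
    then have ge: "exp y0 \<le> \<Phi> (s j)" using IH(3) T by linarith
    then have pj: "\<Phi> (s j) > 0" using exp_gt_zero[of y0] by linarith
    then have y: "y0 \<le> ln (\<Phi> (s j))" using ge by (simp add: ln_ge_iff)
    have \<sigma>: "\<sigma> (s j) \<ge> 0" using G_antimono[OF y] by (simp add: \<sigma>_def)
    have le1: "s j \<le> T + 1" using IH(2) G_nonneg[OF y] G_le by linarith
    then have grow: "2 * \<Phi> (s j) < \<Phi> (s (Suc j))"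
      using contra IH(1) unfolding s_Suc \<sigma>_def by (meson not_le)
    have "ln (\<Phi> (s j)) + ln 2 = ln (2 * \<Phi> (s j))" using pj by (simp add: ln_mult)
    also have "\<dots> \<le> ln (\<Phi> (s (Suc j)))" using grow pj by simp
    finally have "G (ln (\<Phi> (s (Suc j)))) \<le> G (ln (\<Phi> (s j)) + ln 2)"
      using y ln2_ge_two_thirds by (intro G_antimono) linarith+
    moreover have "s (Suc j) = s j + G (ln (\<Phi> (s j))) - G (ln (\<Phi> (s j)) + ln 2)"
      by (simp add: s_Suc \<sigma>_def)
    ultimately show ?case using IH \<sigma> grow by (auto simp: s_Suc)
  qed
  have "2 ^ j * \<Phi> T \<le> \<Phi> (T + 1)" for j
  proof -
    have "1 * \<Phi> T \<le> 2 ^ j * \<Phi> T" using pos by (intro mult_right_mono) auto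
    then have "exp y0 \<le> \<Phi> (s j)" using *[of j] T by linarith
    then have "y0 \<le> ln (\<Phi> (s j))" using exp_gt_zero[of y0] by (subst ln_ge_iff) linarith+
    then have "s j \<le> T + 1" using *[of j] G_nonneg G_le by force
    then show ?thesis using *[of j] monoD[OF mono, of "s j" "T + 1"] by linarith
  qed
  moreover obtain j where "\<Phi> (T + 1) / \<Phi> T < 2 ^ j"
    using real_arch_pow[of 2 "\<Phi> (T + 1) / \<Phi> T"] by auto
  ultimately show False using pos by (auto simp: field_simps not_less[symmetric])
qed

section \<open>Step length and cut-off parameters\<close>

text \<open>The mean value theorem for \<open>ln y powr (- e)\<close> on an interval of length
  \<open>ln 2\<close>. The 4 comes from \<open>ln 2 \<ge> 1/2\<close> and from the denominator of
  the derivative, which at most doubles over the interval.\<close>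

lemma potential_step_lower_bound:
  fixes e :: real
  assumes e: "e > 0"
  shows "\<forall>\<^sub>F y in at_top. ln y powr (- e) - ln (y + ln 2) powr (- e) \<ge> e / (4 * y * ln y powr (1 + e))"
proof -
  have "\<forall>\<^sub>F y::real in at_top. (y + 1) * ln (y + 1) powr (1 + e) \<le> 2 * (y * ln y powr (1 + e))"
    using e by real_asymp
  then show ?thesis using eventually_gt_at_top[of "exp 1"]
  proof eventually_elim
    case (elim y)
    have y: "y > 1" "ln y > 1"
    proof -
      show "y > 1" using elim(2) exp_ge_add_one_self[of 1] by linarith
      then show "ln y > 1"
        using elim(2) ln_less_cancel_iff[of "exp 1" y] by simp
    qed
    have ln2: "ln 2 > (0::real)" "ln 2 \<ge> (1/2::real)" "ln 2 \<le> (1::real)"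
      using ln_le_minus_one[of 2] ln2_ge_two_thirds by auto
    have "\<exists>z>y. z < y + ln 2 \<and> ln (y + ln 2) powr (- e) - ln y powr (- e) = (y + ln 2 - y) * ((- e) * ln z powr (- e - 1) * (1 / z))"
    proof (rule MVT2)
      fix z assume "y \<le> z" "z \<le> y + ln 2"
      then have "z > 0" "ln z > 0" using y by auto
      then show "((\<lambda>z. ln z powr (- e)) has_real_derivative (- e) * ln z powr (- e - 1) * (1 / z)) (at z)"
        by (auto intro!: derivative_eq_intros simp: field_simps)
    qed (use ln2 in auto)
    then obtain z where z: "y < z" "z < y + ln 2"
      and eq: "ln (y + ln 2) powr (- e) - ln y powr (- e) = ln 2 * ((- e) * ln z powr (- e - 1) * (1 / z))"
      by auto
    have lz: "ln z > 1" using z y by (meson less_trans ln_less_cancel_iff zero_less_one)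
    have "z * ln z powr (1 + e) \<le> (y + 1) * ln (y + 1) powr (1 + e)"
      using z y lz ln2 e by (intro mult_mono powr_mono2) auto
    also have "\<dots> \<le> 2 * (y * ln y powr (1 + e))" by (rule elim(1))
    finally have zb: "z * ln z powr (1 + e) \<le> 2 * (y * ln y powr (1 + e))" .
    have "e / (4 * y * ln y powr (1 + e)) = (1/2) * e / (2 * (y * ln y powr (1 + e)))" by simp
    also have "\<dots> \<le> (1/2) * e / (z * ln z powr (1 + e))"
      using zb z y lz e by (intro divide_left_mono mult_pos_pos) auto
    also have "\<dots> \<le> ln 2 * e / (z * ln z powr (1 + e))"
      using z y lz e ln2 by (intro divide_right_mono mult_right_mono) auto
    also have "\<dots> = ln y powr (- e) - ln (y + ln 2) powr (- e)"
    proof -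
      have "- e - 1 = - (1 + e)" by simp
      then have "ln z powr (- e - 1) = 1 / ln z powr (1 + e)"
        by (simp only: powr_minus_divide)
      then show ?thesis using eq by (simp add: algebra_simps)
    qed
    finally show ?case .
  qed
qed

text \<open>Take \<open>N\<close> near x / (ln ln x)^(1 + e) and \<open>q\<close> near (ln x)^2.
  Then N ln q is of order x / (ln ln x)^e, hence o(x). The cut-off degree 4 x / \<sigma> is of order
  at most x ln x (ln ln x)^(1 + e), which is below N ln N (ln ln N)^(2 + 3 e), of order x ln x (ln
  ln x)^(1 + 2 e). The room for both is what an exponent above 2 provides.\<close>

lemma gap_parameters:
  fixes e :: real
  assumes e: "e > 0"
  defines "\<sigma> \<equiv> \<lambda>x. ln (ln x) powr (- e) - ln (ln x + ln 2) powr (- e)"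
  shows "\<forall>\<^sub>F x in at_top. \<exists>N q :: nat. N \<ge> k0 \<and> N \<ge> 1 \<and> q \<ge> 4000000000 \<and> \<sigma> x > 0 \<and>
     1 / real q ^ 2 \<le> \<sigma> x / 2 \<and> 4 * x / \<sigma> x \<le> real N * real q \<and>
     4 * x / \<sigma> x \<le> real N * ln (real N) * ln (ln (real N)) powr (2 + 3 * e) \<and>
     12 * real N * ln (real q) \<le> x / 4"
proof -
  define w where "w x = x * ln (ln x) powr (-1 - e)" for x :: real
  have "filterlim (\<lambda>x::real. ln x) at_top at_top" by real_asymp
  from eventually_compose_filterlim[OF potential_step_lower_bound[OF e] this]
  have "\<forall>\<^sub>F x in at_top. \<sigma> x \<ge> e / (4 * ln x * ln (ln x) powr (1 + e))"
    by (simp add: \<sigma>_def)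
  moreover have "\<forall>\<^sub>F x in at_top. 12 * (w x + 1) * ln (ln x ^ 2 + 1) \<le> x / 4"
    unfolding w_def using e by real_asymp
  moreover have "\<forall>\<^sub>F x in at_top. ln (w x) \<ge> ln x / 2" "\<forall>\<^sub>F x in at_top. ln (ln (w x)) \<ge> ln (ln x) / 2"
     "\<forall>\<^sub>F x in at_top. w x \<ge> real k0" "\<forall>\<^sub>F x in at_top. w x \<ge> 1"
    unfolding w_def using e by real_asymp+
  moreover have "\<forall>\<^sub>F x::real in at_top. ln x ^ 2 \<ge> 4000000000" "\<forall>\<^sub>F x::real in at_top. ln (ln x) > 1" "\<forall>\<^sub>F x::real in at_top. ln x > 1"
    by real_asymp+
  moreover have "\<forall>\<^sub>F x in at_top. 1 / (ln x ^ 2) ^ 2 \<le> e / (4 * ln x * ln (ln x) powr (1 + e)) / 2"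
    using e by real_asymp
  moreover have "\<forall>\<^sub>F x in at_top. 16 / e * (ln x * ln (ln x) powr (1 + e)) \<le> ln (ln x) powr (-1 - e) * ln x ^ 2"
    using e by real_asymp
  moreover have "\<forall>\<^sub>F x::real in at_top. 16 / e * (ln x * ln (ln x) powr (1 + e)) \<le> ln (ln x) powr (-1 - e) * (ln x / 2) * (ln (ln x) / 2) powr (2 + 3 * e)"
    using e by real_asymp
  ultimately show ?thesis using eventually_gt_at_top[of 0]
  proof eventually_elim
    case (elim x)
    define y where "y = ln x"
    define u where "u = ln y"
    define N where "N = nat \<lceil>w x\<rceil>"
    define q where "q = nat \<lceil>y ^ 2\<rceil>"
    have yu: "y > 1" "u > 1" using elim by (simp_all add: y_def u_def)
    have w1: "w x \<ge> 1" "w x \<ge> real k0" using elim by simp_all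
    have N: "real N \<ge> w x" "real N \<le> w x + 1" using w1 by (auto simp: N_def)
    have q: "real q \<ge> y ^ 2" "real q \<le> y ^ 2 + 1" by (auto simp: q_def)
    define d where "d = e / (4 * y * u powr (1 + e))"
    have \<sigma>: "\<sigma> x \<ge> d" using elim by (simp add: y_def u_def d_def)
    have \<sigma>0: "d > 0" using e yu by (simp add: d_def)
    have "4 * x / \<sigma> x \<le> 4 * x / d"
      using \<sigma> \<sigma>0 elim(13) by (intro divide_left_mono mult_pos_pos) linarith+
    also have "\<dots> = x * (16 / e * (y * u powr (1 + e)))" by (simp add: d_def)
    finally have \<Lambda>: "4 * x / \<sigma> x \<le> x * (16 / e * (y * u powr (1 + e)))" .
    show ?case
    proof (rule exI[of _ N], rule exI[of _ q], intro conjI)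
      have "real N \<ge> real k0" "real N \<ge> 1" using N w1 by linarith+
      then show "k0 \<le> N" "1 \<le> N" by auto
      have "real q \<ge> 4000000000" using q elim by (simp add: y_def)
      then show "4000000000 \<le> q" by linarith
      show "\<sigma> x > 0" using \<sigma> \<sigma>0 by linarith
      have "1 / real q ^ 2 \<le> 1 / (y ^ 2) ^ 2"
        using q yu by (intro frac_le power_mono) auto
      also have "\<dots> \<le> d / 2" using elim by (simp add: y_def u_def d_def)
      finally show "1 / real q ^ 2 \<le> \<sigma> x / 2" using \<sigma> by linarith
      have "x * (16 / e * (y * u powr (1 + e))) \<le> x * (u powr (-1 - e) * y ^ 2)"
        using elim(11) elim(13) unfolding y_def u_def by (intro mult_left_mono) auto
      also have "\<dots> = w x * y ^ 2" by (simp add: w_def y_def u_def)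
      also have "\<dots> \<le> real N * real q" using N q w1 by (intro mult_mono) auto
      finally show "4 * x / \<sigma> x \<le> real N * real q" using \<Lambda> by linarith
      have "x * (16 / e * (y * u powr (1 + e))) \<le> x * (u powr (-1 - e) * (y / 2) * (u / 2) powr (2 + 3 * e))"
        using elim(12) elim(13) unfolding y_def u_def by (intro mult_left_mono) auto
      also have "\<dots> = w x * (y / 2) * (u / 2) powr (2 + 3 * e)" by (simp add: w_def y_def u_def)
      also have "\<dots> \<le> real N * ln (real N) * ln (ln (real N)) powr (2 + 3 * e)"
      proof (intro mult_mono powr_mono2)
        have "ln (w x) \<le> ln (real N)" using N w1 by simp
        then show *: "y / 2 \<le> ln (real N)" using elim by (simp add: y_def)
        have "ln (w x) > 0" using elim(3) yu(1) unfolding y_def by linarith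
        then have "ln (ln (w x)) \<le> ln (ln (real N))" using \<open>ln (w x) \<le> ln (real N)\<close> by simp
        then show "u / 2 \<le> ln (ln (real N))" using elim by (simp add: y_def u_def)
      qed (use yu N w1 e in auto)
      finally show "4 * x / \<sigma> x \<le> real N * ln (real N) * ln (ln (real N)) powr (2 + 3 * e)" using \<Lambda> by linarith
      have "12 * real N * ln (real q) \<le> 12 * (w x + 1) * ln (y ^ 2 + 1)"
        using N q yu w1 \<open>real q \<ge> 4000000000\<close> by (intro mult_mono) auto
      also have "\<dots> \<le> x / 4" using elim by (simp add: y_def)
      finally show "12 * real N * ln (real q) \<le> x / 4" .
    qed
  qed
qed

section \<open>Power series and their majorants\<close>

lemma norm_summable_of_power_series:
  fixes c :: "nat \<Rightarrow> complex" and l :: "nat \<Rightarrow> nat"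
  assumes sums: "\<And>z. (\<lambda>k. c k * z ^ l k) sums g z" and l: "strict_mono l"
  shows "summable (\<lambda>k. norm (c k) * r ^ l k)"
proof -
  define s where "s = 2 * (\<bar>r\<bar> + 1)"
  have s: "s > 0" by (simp add: s_def)
  have "(\<lambda>k. c k * of_real s ^ l k) \<longlonglongrightarrow> 0"
    using sums summable_LIMSEQ_zero sums_summable by blast
  then have "Bseq (\<lambda>k. c k * of_real s ^ l k)" by (rule convergentI[THEN convergent_imp_Bseq])
  then obtain A where A: "\<And>k. norm (c k * of_real s ^ l k) \<le> A" by (auto simp: Bseq_def)
  have A0: "A \<ge> 0" using A[of 0] norm_ge_zero order_trans by blast
  show ?thesis
  proof (rule summable_comparison_test'[of "\<lambda>k. A * (1 / 2) ^ k"])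
    show "summable (\<lambda>k. A * (1 / 2 :: real) ^ k)" by (intro summable_mult summable_geometric) simp
    fix k
    have "norm (norm (c k) * r ^ l k) = norm (c k) * s ^ l k * (\<bar>r\<bar> / s) ^ l k"
      using s by (simp add: abs_mult power_abs power_divide)
    also have "\<dots> \<le> A * (1 / 2) ^ l k"
    proof (intro mult_mono power_mono)
      show "norm (c k) * s ^ l k \<le> A" using A[of k] s by (simp add: norm_mult norm_power)
      show "\<bar>r\<bar> / s \<le> 1 / 2" using s by (simp add: s_def field_simps)
    qed (use A0 s in auto)
    also have "\<dots> \<le> A * (1 / 2) ^ k"
      using strict_mono_imp_increasing[OF l, of k] A0 by (intro mult_left_mono power_decreasing) auto
    finally show "norm (norm (c k) * r ^ l k) \<le> A * (1 / 2) ^ k" .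
  qed
qed

text \<open>The majorant with absolute values; its logarithm at \<open>exp t\<close> is the \<Phi>
  of the growth argument. Unlike the maximum modulus it splits additively into head and
  tail.\<close>

definition abs_series :: "(nat \<Rightarrow> complex) \<Rightarrow> (nat \<Rightarrow> nat) \<Rightarrow> real \<Rightarrow> real" where
  "abs_series c l r = (\<Sum>k. norm (c k) * r ^ l k)"

lemma abs_series_mono:
  assumes "\<And>r. summable (\<lambda>k. norm (c k) * r ^ l k)" "0 \<le> r" "r \<le> s"
  shows "abs_series c l r \<le> abs_series c l s"
  unfolding abs_series_def by (intro suminf_le mult_left_mono power_mono assms) auto

text \<open>For exponents n \<ge> \<Lambda> and r \<le> s one has r^n \<le> (r / s)^\<Lambda> s^n,
  so the tail at \<open>r\<close> is paid for by the full series at \<open>s\<close>.\<close>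

lemma abs_series_split:
  assumes sum: "\<And>r. summable (\<lambda>k. norm (c k) * r ^ l k)" and r: "r > 0" "r \<le> s"
    and I: "finite I" and I': "\<And>k. k \<notin> I \<Longrightarrow> real (l k) \<ge> \<Lambda>"
  shows "(\<Sum>k. norm (if k \<in> I then 0 else c k) * r ^ l k) \<le> (r / s) powr \<Lambda> * abs_series c l s"
    (is ?tail)
  and "summable (\<lambda>k. norm (if k \<in> I then 0 else c k) * r ^ l k)" (is ?sum)
  and "(\<Sum>k\<in>I. norm (c k) * r ^ l k) \<ge> abs_series c l r - (r / s) powr \<Lambda> * abs_series c l s"
    (is ?head)
proof -
  show 1: ?sum
    by (rule summable_comparison_test'[OF sum[of r], of 0]) (use r in \<open>auto simp: abs_mult\<close>)
  have s: "s > 0" using r by simp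
  have "(\<Sum>k. norm (if k \<in> I then 0 else c k) * r ^ l k) \<le> (\<Sum>k. (r / s) powr \<Lambda> * (norm (c k) * s ^ l k))"
  proof (rule suminf_le[OF _ 1 summable_mult[OF sum[of s]]])
    fix k
    show "norm (if k \<in> I then 0 else c k) * r ^ l k \<le> (r / s) powr \<Lambda> * (norm (c k) * s ^ l k)"
    proof (cases "k \<in> I")
      case False
      have "(r / s) ^ l k = (r / s) powr real (l k)" using r s by (simp add: powr_realpow)
      also have "\<dots> \<le> (r / s) powr \<Lambda>"
        using r s I'[OF False] by (intro powr_mono') auto
      finally have "r ^ l k \<le> (r / s) powr \<Lambda> * s ^ l k"
        using s by (simp add: power_divide field_simps)
      then have "norm (c k) * r ^ l k \<le> norm (c k) * ((r / s) powr \<Lambda> * s ^ l k)"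
        by (intro mult_left_mono) auto
      then show ?thesis using False by (simp add: mult_ac)
    qed (use s in simp)
  qed
  also have "\<dots> = (r / s) powr \<Lambda> * abs_series c l s"
    unfolding abs_series_def by (rule suminf_mult[OF sum[of s]])
  finally show 2: ?tail .
  have "abs_series c l r = (\<Sum>k. (if k \<in> I then norm (c k) * r ^ l k else 0) + norm (if k \<in> I then 0 else c k) * r ^ l k)"
    unfolding abs_series_def by (rule suminf_cong) simp
  also have "\<dots> = (\<Sum>k. if k \<in> I then norm (c k) * r ^ l k else 0) + (\<Sum>k. norm (if k \<in> I then 0 else c k) * r ^ l k)"
    by (rule suminf_add[symmetric]) (use 1 I in auto)
  also have "(\<Sum>k. if k \<in> I then norm (c k) * r ^ l k else 0) = (\<Sum>k\<in>I. norm (c k) * r ^ l k)"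
    using sums_If_finite_set[OF I, of "\<lambda>k. norm (c k) * r ^ l k"] by (simp add: sums_iff)
  finally show ?head using 2 by simp
qed

text \<open>With x = \<Phi>(t), the terms of degree below \<Lambda> form a sum with at most
  \<open>N\<close> terms and total coefficient size at least e^x - 1.
  \<open>gap_sum_min_modulus\<close> loses at most e^(x/4), and the tail is at most 1, so e^(x/2)
  survives on a circle; this dominates the square root of the majorant at
  \<open>exp T\<close>.\<close>

lemma gap_series_min_modulus:
  fixes c :: "nat \<Rightarrow> complex" and l :: "nat \<Rightarrow> nat" and \<alpha> :: real
  assumes sums: "\<And>z. (\<lambda>k. c k * z ^ l k) sums g z" and l: "strict_mono l"
    and \<alpha>: "\<alpha> > 2"
    and growth: "\<forall>\<^sub>F k in sequentially. real (l k) > real k * ln (real k) * ln (ln (real k)) powr \<alpha>"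
    and unbounded: "filterlim (\<lambda>t. abs_series c l (exp t)) at_top at_top"
  shows "\<forall>\<^sub>F T in at_top. \<exists>t. T \<le> t \<and> t \<le> T + 2 \<and>
     (\<forall>z. norm z = exp t \<longrightarrow> sqrt (abs_series c l (exp T)) \<le> norm (g z))"
proof -
  note sum = norm_summable_of_power_series[OF sums l]
  define e where "e = (\<alpha> - 2) / 3"
  have e: "e > 0" "\<alpha> = 2 + 3 * e" using \<alpha> by (simp_all add: e_def field_simps)
  define \<sigma> where "\<sigma> x = ln (ln x) powr (- e) - ln (ln x + ln 2) powr (- e)" for x :: real
  obtain k0 where k0: "\<And>k. k \<ge> k0 \<Longrightarrow> real (l k) > real k * ln (real k) * ln (ln (real k)) powr \<alpha>"
    using growth unfolding eventually_sequentially by blast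
  define \<Phi> where "\<Phi> t = ln (abs_series c l (exp t))" for t
  have "filterlim \<Phi> at_top at_top"
    unfolding \<Phi>_def by (rule filterlim_compose[OF ln_at_top unbounded])
  have abs_mono: "abs_series c l (exp t) \<le> abs_series c l (exp t')" if "t \<le> t'" for t t'
    by (rule abs_series_mono[OF sum]) (use that in auto)
  have nonneg: "abs_series c l (exp t) \<ge> 0" for t
    unfolding abs_series_def by (rule suminf_nonneg[OF sum]) auto
  obtain x0 where x0: "\<And>x. x \<ge> x0 \<Longrightarrow> \<exists>N q :: nat. N \<ge> k0 \<and> N \<ge> 1 \<and> q \<ge> 4000000000 \<and> \<sigma> x > 0 \<and>
     1 / real q ^ 2 \<le> \<sigma> x / 2 \<and> 4 * x / \<sigma> x \<le> real N * real q \<and>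
     4 * x / \<sigma> x \<le> real N * ln (real N) * ln (ln (real N)) powr \<alpha> \<and>
     12 * real N * ln (real q) \<le> x / 4"
    using gap_parameters[OF e(1), of k0] unfolding \<sigma>_def e(2)[symmetric] eventually_at_top_linorder by blast
  have "\<forall>\<^sub>F T in at_top. \<Phi> T \<ge> max x0 (max 100 (exp (exp 1)))"
    using \<open>filterlim \<Phi> at_top at_top\<close> unfolding filterlim_at_top by blast
  then show ?thesis
  proof eventually_elim
    case (elim T)
    have pos: "abs_series c l (exp T) > 0"
    proof (rule ccontr)
      assume "\<not> ?thesis"
      then have "\<Phi> T = 0" using nonneg[of T] by (simp add: \<Phi>_def)
      then show False using elim by simp
    qed
    \<comment> \<open>the value of \<open>\<Phi>\<close> to the left of \<open>T\<close> is irrelevant and may be junk\<close>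
    define \<Psi> where "\<Psi> t = \<Phi> (max T t)" for t
    have \<Phi>_mono: "\<Phi> t \<le> \<Phi> t'" if "T \<le> t" "t \<le> t'" for t t'
      using abs_mono[OF that(1)] abs_mono[OF that(2)] pos by (simp add: \<Phi>_def)
    have exp\<Phi>: "exp (\<Phi> t) = abs_series c l (exp t)" if "T \<le> t" for t
      using abs_mono[OF that] pos by (simp add: \<Phi>_def)
    have "\<exists>t. T \<le> t \<and> t \<le> T + 1 \<and> \<Psi> (t + (ln (ln (\<Psi> t)) powr (- e) - ln (ln (\<Psi> t) + ln 2) powr (- e))) \<le> 2 * \<Psi> t"
    proof (rule borel_growth[of \<Psi> "exp 1" T "\<lambda>y. ln y powr (- e)"])
      show "mono \<Psi>" by (rule monoI) (auto simp: \<Psi>_def intro!: \<Phi>_mono)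
      show "exp (exp 1) \<le> \<Psi> T" using elim by (simp add: \<Psi>_def)
      show "ln y' powr (- e) \<le> ln y powr (- e)" if "exp 1 \<le> y" "y \<le> y'" for y y'
      proof (rule powr_mono2')
        have y0: "0 < y" using that(1) exp_gt_zero[of "1::real"] by linarith
        then show "ln y \<le> ln y'" using that by simp
        have "1 \<le> ln y" using that(1) y0 by (simp add: ln_ge_iff)
        then show "0 < ln y" by simp
      qed (use e in simp)
    qed auto
    then obtain t where t: "T \<le> t" "t \<le> T + 1" and "\<Psi> (t + \<sigma> (\<Psi> t)) \<le> 2 * \<Psi> t"
      unfolding \<sigma>_def by blast
    then have grow: "\<Phi> (max T (t + \<sigma> (\<Phi> t))) \<le> 2 * \<Phi> t"
      by (simp add: \<Psi>_def max_absorb2)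
    define x where "x = \<Phi> t"
    have x: "x \<ge> x0" "x \<ge> 100" using elim \<Phi>_mono[of T t] t by (auto simp: x_def)
    obtain N q :: nat where Nq: "N \<ge> k0" "N \<ge> 1" "q \<ge> 4000000000" "\<sigma> x > 0"
      "1 / real q ^ 2 \<le> \<sigma> x / 2" "4 * x / \<sigma> x \<le> real N * real q"
      "4 * x / \<sigma> x \<le> real N * ln (real N) * ln (ln (real N)) powr \<alpha>"
      "12 * real N * ln (real q) \<le> x / 4"
      using x0[OF x(1)] by blast
    define \<Lambda> where "\<Lambda> = 4 * x / \<sigma> x"
    define I where "I = {k. real (l k) < \<Lambda>}"
    \<comment> \<open>By the choice of \<open>N\<close> the cut-off \<open>\<Lambda>\<close> is at
      most N ln N (ln ln N)^\<alpha>, and this is below \<open>l N\<close>.\<close>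
    have "I \<subseteq> {..<N}"
    proof
      fix k assume "k \<in> I"
      then have "real (l k) < real (l N)" using Nq(7) k0[OF Nq(1)] by (simp add: I_def \<Lambda>_def)
      then have "l k < l N" by simp
      then show "k \<in> {..<N}" using strict_mono_less[OF l] by simp
    qed
    then have I: "finite I" "card I \<le> N"
      using finite_subset card_mono[of "{..<N}" I] by auto
    \<comment> \<open>Moving \<open>exp t\<close> into the coefficients turns the circle of radius
      \<open>exp (t + s)\<close> into the line with real part \<open>s\<close>.\<close>
    define b where "b k = c k * exp (of_nat (l k) * of_real t)" for k
    have lI: "l i \<le> N * q" if "i \<in> I" for i
    proof -
      have "real (l i) \<le> real (N * q)" using that Nq(6) by (simp add: I_def \<Lambda>_def)
      then show ?thesis by (simp only: of_nat_le_iff)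
    qed
    have "\<exists>s. 0 \<le> s \<and> s \<le> 1 / real q ^ 2 \<and>
       (\<forall>\<theta>. (\<Sum>i\<in>I. norm (b i)) / real q ^ (12 * N) \<le> norm (exp_sum I b l (Complex s \<theta>)))"
      by (rule gap_sum_min_modulus[OF I Nq(2) _ Nq(3) lI])
         (use strict_mono_on_imp_inj_on l in \<open>auto intro: inj_on_subset\<close>)
    then obtain s where s: "0 \<le> s" "s \<le> 1 / real q ^ 2"
      and min: "\<And>\<theta>. (\<Sum>i\<in>I. norm (b i)) / real q ^ (12 * N) \<le> norm (exp_sum I b l (Complex s \<theta>))"
      by blast
    have q1: "1 / real q ^ 2 \<le> 1"
      using Nq(3) by (simp add: divide_le_eq)
    have big: "abs_series c l (exp (t + \<sigma> x)) \<le> exp (2 * x)"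
    proof -
      have "max T (t + \<sigma> x) = t + \<sigma> x" using t Nq(4) by simp
      then have "\<Phi> (t + \<sigma> x) \<le> 2 * x" using grow by (simp add: x_def)
      moreover have "exp (\<Phi> (t + \<sigma> x)) = abs_series c l (exp (t + \<sigma> x))"
        using t Nq(4) by (intro exp\<Phi>) simp
      ultimately show ?thesis by (metis exp_le_cancel_iff)
    qed
    \<comment> \<open>A distance of at least \<sigma> / 2 to \<open>t + \<sigma> x\<close> gains
      exp(- \<Lambda> \<sigma> / 2) = exp(- 2 x), by \<Lambda> = 4 x / \<sigma>. This cancels the
      bound exp(2 x) obtained from Borel's lemma.\<close>
    have tail: "(exp v / exp (t + \<sigma> x)) powr \<Lambda> * abs_series c l (exp (t + \<sigma> x)) \<le> 1"
      if v: "v \<le> t + \<sigma> x / 2" for v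
    proof -
      have "\<Lambda> \<ge> 0" using Nq(4) x by (simp add: \<Lambda>_def)
      have "exp v / exp (t + \<sigma> x) \<le> exp (- \<sigma> x / 2)"
        using v by (simp add: exp_diff[symmetric])
      then have "(exp v / exp (t + \<sigma> x)) powr \<Lambda> \<le> exp (- \<sigma> x / 2) powr \<Lambda>"
        using \<open>\<Lambda> \<ge> 0\<close> by (intro powr_mono2) auto
      also have "\<dots> = exp (- 2 * x)"
        using Nq(4) by (simp add: powr_def \<Lambda>_def)
      finally have "(exp v / exp (t + \<sigma> x)) powr \<Lambda> * abs_series c l (exp (t + \<sigma> x)) \<le> exp (- 2 * x) * exp (2 * x)"
        using big nonneg by (intro mult_mono) auto
      also have "\<dots> = 1" by (simp flip: exp_add)
      finally show ?thesis .
    qed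
    have I_large: "k \<notin> I \<Longrightarrow> real (l k) \<ge> \<Lambda>" for k by (simp add: I_def)
    have normb: "norm (b k) = norm (c k) * exp t ^ l k" for k
      by (simp add: b_def norm_mult exp_of_nat_mult norm_power)
    have B: "(\<Sum>i\<in>I. norm (b i)) \<ge> exp x - 1"
    proof -
      have "(\<Sum>i\<in>I. norm (b i)) \<ge> abs_series c l (exp t) - (exp t / exp (t + \<sigma> x)) powr \<Lambda> * abs_series c l (exp (t + \<sigma> x))"
        unfolding normb by (rule abs_series_split(3)[OF sum _ _ I(1) I_large]) (use Nq(4) in auto)
      then show ?thesis using tail[of t] exp\<Phi>[OF t(1)] Nq(4) by (simp add: x_def)
    qed
    show ?case
    proof (rule exI[of _ "t + s"], intro conjI allI impI)
      show "T \<le> t + s" "t + s \<le> T + 2" using t s q1 by auto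
      fix z :: complex assume z: "norm z = exp (t + s)"
      then have "z \<noteq> 0" by auto
      define \<theta> where "\<theta> = Arg z"
      have zeq: "z = exp (of_real t + Complex s \<theta>)"
      proof -
        have "z = of_real (norm z) * exp (\<i> * of_real (Arg z))"
          using \<open>z \<noteq> 0\<close> by (rule Arg_eq)
        also have "\<dots> = exp (of_real (t + s) + \<i> * of_real \<theta>)"
          unfolding z exp_add \<theta>_def exp_of_real ..
        also have "of_real (t + s) + \<i> * of_real \<theta> = of_real t + Complex s \<theta>"
          by (simp add: complex_eq_iff)
        finally show ?thesis .
      qed
      have term_eq: "c k * z ^ l k = b k * exp (of_nat (l k) * Complex s \<theta>)" for k
        unfolding zeq b_def exp_of_nat_mult[symmetric] ring_distribs by (simp only: exp_add mult.assoc)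
      have "(\<lambda>k. (if k \<in> I then c k * z ^ l k else 0)) sums exp_sum I b l (Complex s \<theta>)"
        unfolding exp_sum_def term_eq by (rule sums_If_finite_set[OF I(1)])
      from sums_diff[OF sums this]
      have "(\<lambda>k. (if k \<in> I then 0 else c k) * z ^ l k) sums (g z - exp_sum I b l (Complex s \<theta>))"
        by (rule sums_cong[THEN iffD1, rotated]) auto
      then have "g z - exp_sum I b l (Complex s \<theta>) = (\<Sum>k. (if k \<in> I then 0 else c k) * z ^ l k)"
        by (simp add: sums_iff)
      moreover have "norm (\<Sum>k. (if k \<in> I then 0 else c k) * z ^ l k) \<le> (\<Sum>k. norm ((if k \<in> I then 0 else c k) * z ^ l k))"
        by (rule summable_norm)
           (use abs_series_split(2)[OF sum _ order_refl I(1) I_large, of "exp (t + s)"] in \<open>simp add: norm_mult norm_power z\<close>)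
      moreover have "\<dots> \<le> (exp (t + s) / exp (t + \<sigma> x)) powr \<Lambda> * abs_series c l (exp (t + \<sigma> x))"
        unfolding norm_mult norm_power z
        by (rule abs_series_split(1)[OF sum _ _ I(1) I_large]) (use Nq(4,5) s in auto)
      moreover have "\<dots> \<le> 1" by (rule tail) (use Nq(5) s in simp)
      ultimately have diff: "norm (g z - exp_sum I b l (Complex s \<theta>)) \<le> 1" by simp
      \<comment> \<open>The summand 1 on the left is reserved for the tail. In terms of w = e^(x/4),
        which is at least 26 for x \<ge> 100, the claim is (w^2 + 1) w \<le> w^4 - 1.\<close>
      have "exp (x / 2) + 1 \<le> (exp x - 1) / exp (x / 4)"
      proof -
        have "x / 4 + 1 \<le> exp (x / 4)" using exp_ge_add_one_self[of "x / 4"] by (simp add: add.commute)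
        then have w: "exp (x / 4) \<ge> 26" using x by simp
        define w where "w = exp (x / 4)"
        have "exp (x / 2) = w ^ 2" "exp x = w ^ 4"
          by (simp_all add: w_def flip: exp_of_nat_mult)
        moreover have "(w ^ 2 + 1) * w \<le> w ^ 4 - 1"
        proof -
          have "w ^ 4 - 1 - (w ^ 2 + 1) * w = w ^ 3 * (w - 2) + w * (w ^ 2 - 2) + (w - 1)"
            by (simp add: algebra_simps power4_eq_xxxx power3_eq_cube power2_eq_square)
          moreover have "w ^ 2 \<ge> 26 ^ 2" using w unfolding w_def by (intro power_mono) auto
          then have "0 \<le> w ^ 3 * (w - 2)" "0 \<le> w * (w ^ 2 - 2)" "0 \<le> w - 1"
            using w unfolding w_def[symmetric] by auto
          ultimately show ?thesis by linarith
        qed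
        ultimately show ?thesis using w by (simp add: w_def[symmetric] le_divide_eq)
      qed
      also have "\<dots> \<le> (\<Sum>i\<in>I. norm (b i)) / real q ^ (12 * N)"
      proof (rule frac_le)
        have "real q ^ (12 * N) = exp (12 * real N * ln (real q))"
          using Nq(3) exp_of_nat_mult[of "12 * N" "ln (real q)"] by simp
        also have "\<dots> \<le> exp (x / 4)" using Nq(8) by simp
        finally show "real q ^ (12 * N) \<le> exp (x / 4)" .
        show "0 < real q ^ (12 * N)" using Nq(3) by simp
      qed (use B in \<open>auto intro: sum_nonneg\<close>)
      also have "\<dots> \<le> norm (exp_sum I b l (Complex s \<theta>))" by (rule min)
      finally have "exp (x / 2) \<le> norm (g z)"
        using diff norm_triangle_sub[of "exp_sum I b l (Complex s \<theta>)" "g z"]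
        by (simp add: norm_minus_commute)
      moreover have "sqrt (abs_series c l (exp T)) \<le> exp (x / 2)"
      proof -
        have "abs_series c l (exp T) \<le> exp x"
          using abs_mono[OF t(1)] exp\<Phi>[OF t(1)] by (simp add: x_def)
        also have "\<dots> = exp (x / 2) ^ 2" by (simp flip: exp_of_nat_mult)
        finally show ?thesis using real_le_lsqrt by simp
      qed
      ultimately show "sqrt (abs_series c l (exp T)) \<le> norm (g z)" by linarith
    qed
  qed
qed

subsection \<open>Spider's webs\<close>

locale entire_function =
  fixes g :: "complex \<Rightarrow> complex"
  assumes hol: "g holomorphic_on UNIV" and nonconst: "\<not> g constant_on UNIV"
begin

abbreviation M :: "real \<Rightarrow> real" where "M r \<equiv> max_modulus r g"

lemma continuous: "continuous_on S g"
  using hol holomorphic_on_imp_continuous_on continuous_on_subset by blast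

lemma M_attained: "r \<ge> 0 \<Longrightarrow> \<exists>z. norm z = r \<and> norm (g z) = M r"
  using max_modulus_attained[OF continuous] by force

lemma norm_le_M: "norm (g z) \<le> M (norm z)"
  using max_modulus_attained[OF continuous, of "norm z"] by force

lemma M_strict_mono:
  assumes "0 \<le> r" "r < s" shows "M r < M s"
proof (rule ccontr)
  assume "\<not> ?thesis"
  then have le: "M s \<le> M r" by simp
  obtain z where z: "norm z = r" "norm (g z) = M r" using M_attained[OF assms(1)] by blast
  have "norm (g w) \<le> M s" if "w \<in> ball 0 s" for w
  proof (rule maximum_modulus_frontier[of g "ball 0 s"])
    show "g holomorphic_on interior (ball 0 s)" using hol holomorphic_on_subset by blast
    fix v :: complex assume "v \<in> frontier (ball 0 s)"
    then have "norm v = s" using assms by simp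
    then show "norm (g v) \<le> M s" using norm_le_M by metis
  qed (use that continuous in auto)
  then have "norm (g w) \<le> norm (g z)" if "w \<in> ball 0 s" for w using that le z by force
  then have "g constant_on UNIV"
    using maximum_modulus_principle[of g UNIV "ball 0 s" z] hol z assms by auto
  then show False using nonconst by simp
qed

lemma M_nonneg: "r \<ge> 0 \<Longrightarrow> M r \<ge> 0"
  using M_attained[of r] norm_ge_zero by metis

lemma norm_less_M: "norm z < r \<Longrightarrow> norm (g z) < M r"
  using norm_le_M[of z] M_strict_mono[of "norm z" r] by auto

lemma holomorphic_iterate: "(g ^^ n) holomorphic_on UNIV"
proof (induction n)
  case 0
  have "g ^^ 0 = (\<lambda>z. z)" by auto
  then show ?case by (simp add: holomorphic_on_ident)
next
  case (Suc n)
  then show ?case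
    using holomorphic_on_compose_gen[OF Suc hol] by (simp add: o_def)
qed

lemma continuous_iterate: "continuous_on S (\<lambda>z. norm ((g ^^ n) z))"
  using holomorphic_iterate holomorphic_on_imp_continuous_on continuous_on_subset continuous_on_norm by blast

end

section \<open>Level sets of escape and their complements\<close>

locale escaping = entire_function +
  fixes R :: real
  assumes R: "R > 0" and M_gt: "\<And>r. r \<ge> R \<Longrightarrow> M r > r"
begin

definition a :: "nat \<Rightarrow> real" where "a n = (M ^^ n) R"

lemma a_0: "a 0 = R" and a_Suc: "a (Suc n) = M (a n)"
  by (simp_all add: a_def)

lemma a_ge: "a n \<ge> R"
proof (induction n)
  case (Suc n)
  then show ?case using M_gt[of "a n"] by (simp add: a_Suc)
qed (simp add: a_0)

lemma a_pos: "a n > 0"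
  using a_ge[of n] R by linarith

lemma strict_mono_a: "strict_mono a"
  by (rule strict_monoI_Suc) (use M_gt a_ge in \<open>simp add: a_Suc\<close>)

lemma a_at_top: "filterlim a at_top sequentially"
proof -
  have unb: "\<exists>n. B < a n" for B
  proof (rule ccontr)
    assume "\<not> ?thesis"
    then have "\<forall>n. a n \<le> B" by (auto simp: not_less)
    then obtain L where L: "a \<longlonglongrightarrow> L" "\<forall>n. a n \<le> L"
      using incseq_convergent[OF strict_mono_mono[OF strict_mono_a]] by blast
    have "L \<ge> R" using L(2)[rule_format, of 0] by (simp add: a_0)
    then have "M L > L" by (rule M_gt)
    \<comment> \<open>Continuity of \<open>g\<close> along the radius through a point where
      \<open>M L\<close> is attained stands in for continuity of \<open>M\<close>: it forces some
      \<open>a (Suc n)\<close> above the supposed limit \<open>L\<close>.\<close>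
    obtain z where z: "norm z = L" "norm (g z) = M L"
      using M_attained[of L] \<open>L \<ge> R\<close> R by auto
    have "((\<lambda>n. of_real (a n / L) * z) \<longlongrightarrow> of_real (L / L) * z) sequentially"
      using \<open>L \<ge> R\<close> R by (intro tendsto_intros L(1)) auto
    then have "((\<lambda>n. norm (g (of_real (a n / L) * z))) \<longlongrightarrow> norm (g z)) sequentially"
      using \<open>L \<ge> R\<close> R continuous_on_tendsto_compose[OF continuous[of UNIV]]
      by (intro tendsto_norm) (auto simp del: of_real_divide)
    then have "\<forall>\<^sub>F n in sequentially. norm (g (of_real (a n / L) * z)) > L"
      using z(2) \<open>M L > L\<close> by (intro order_tendstoD(1)) auto
    then obtain n where n: "norm (g (of_real (a n / L) * z)) > L"
      by (auto simp: eventually_sequentially)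
    have "norm (of_real (a n / L) * z) = a n"
      using z(1) a_pos[of n] \<open>L \<ge> R\<close> R by (simp add: norm_mult norm_divide)
    then have "norm (g (of_real (a n / L) * z)) \<le> a (Suc n)"
      using norm_le_M[of "of_real (a n / L) * z"] by (simp add: a_Suc)
    then show False using n L(2)[rule_format, of "Suc n"] by simp
  qed
  show ?thesis
    unfolding filterlim_at_top
  proof
    fix B
    obtain n where "B < a n" using unb by blast
    then have "B \<le> a m" if "m \<ge> n" for m
      using strict_mono_leD[OF strict_mono_a that] by linarith
    then show "\<forall>\<^sub>F n in sequentially. B \<le> a n" by (auto simp: eventually_sequentially)
  qed
qed

lemma iterate_below_Suc:
  assumes "norm ((g ^^ n) z) < a (n + m)"
  shows "norm ((g ^^ Suc n) z) < a (Suc n + m)"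
  using norm_less_M[OF assms] by (simp add: a_Suc)

lemma iterate_below_mono:
  assumes "n \<le> n'" "norm ((g ^^ n) z) < a (n + m)"
  shows "norm ((g ^^ n') z) < a (n' + m)"
  using assms by (induction n' rule: dec_induct) (use iterate_below_Suc in blast)+

text \<open>The shift by \<open>m\<close> is what makes the holes around \<open>0\<close> exhaust the plane while their boundaries stay in \<open>E 0\<close>.\<close>

definition E :: "nat \<Rightarrow> complex set" where
  "E m = {z. \<forall>n\<ge>1. norm ((g ^^ n) z) \<ge> a (n + m)}"

lemma A_set_eq: "A_set R g = E 0"
  by (simp add: A_set_def E_def a_def)

lemma E_subset: "E m \<subseteq> E 0"
proof -
  have "a n \<le> a (n + m)" for n by (rule strict_mono_leD[OF strict_mono_a]) simp
  then show ?thesis by (auto simp: E_def intro: order_trans)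
qed

lemma closed_level: "closed {z. norm ((g ^^ n) z) \<ge> c}"
  by (intro closed_Collect_le continuous_on_const continuous_iterate)

lemma closed_E: "closed (E m)"
proof -
  have "E m = (\<Inter>n\<in>{1..}. {z. norm ((g ^^ n) z) \<ge> a (n + m)})"
    by (auto simp: E_def)
  then show ?thesis using closed_level by auto
qed

text \<open>Once an orbit falls below its level it stays below. Hence the parts of \<open>K\<close>
  that are not yet below decrease with \<open>n\<close>; if none were empty, compactness would give
  a common point, which would lie in \<open>E m\<close>.\<close>

lemma compact_below_level:
  assumes K: "compact K" "K \<inter> E m = {}"
  shows "\<exists>n\<ge>1. \<forall>z\<in>K. norm ((g ^^ n) z) < a (n + m)"
proof (rule ccontr)
  assume contra: "\<not> ?thesis"
  define F where "F n = K \<inter> {z. norm ((g ^^ Suc n) z) \<ge> a (Suc n + m)}" for n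
  have "\<Inter>(range F) \<noteq> {}"
  proof (rule compact_nest)
    show "compact (F n)" for n unfolding F_def by (intro compact_Int_closed K closed_level)
    show "F n \<noteq> {}" for n using contra[simplified, rule_format, of "Suc n"] by (force simp: F_def not_less)
    show "F n \<subseteq> F k" if "k \<le> n" for k n
    proof
      fix z assume z: "z \<in> F n"
      show "z \<in> F k"
      proof (rule ccontr)
        assume "z \<notin> F k"
        then have "norm ((g ^^ Suc k) z) < a (Suc k + m)" using z unfolding F_def by force
        then have "norm ((g ^^ Suc n) z) < a (Suc n + m)"
          by (rule iterate_below_mono[rotated]) (use that in simp)
        then show False using z unfolding F_def by simp
      qed
    qed
  qed
  then obtain z where z: "\<And>n. z \<in> F n" by auto
  then have "z \<in> K" by (auto simp: F_def)
  moreover have "z \<in> E m"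
    unfolding E_def
  proof (intro CollectI allI impI)
    fix n :: nat assume "n \<ge> 1"
    then obtain k where "n = Suc k" by (cases n) auto
    then show "a (n + m) \<le> norm ((g ^^ n) z)" using z[of k] unfolding F_def by blast
  qed
  ultimately show False using K by blast
qed

text \<open>By the Sura-Bura theorem a bounded component lies in a compact, relatively open piece
  \<open>K\<close> of \<open>E m\<close>. Half its distance \<open>d\<close> to the rest gives a
  bounded neighbourhood \<open>W\<close> whose frontier misses \<open>E m\<close>. There some
  iterate is below its level, and the maximum principle carries this to the points of
  \<open>K\<close>, which belong to \<open>E m\<close>.\<close>

lemma component_E_unbounded:
  assumes C: "C \<in> components (E m)"
  shows "\<not> bounded C"
proof
  assume "bounded C"
  then have "compact C"
    using closed_components[OF closed_E C] by (simp add: compact_eq_bounded_closed)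
  then obtain K where K: "openin (top_of_set (E m)) K" "compact K" "C \<subseteq> K"
    using Sura_Bura_clopen_subset[OF closed_imp_locally_compact[OF closed_E] C _ open_UNIV] by auto
  have "C \<noteq> {}" using C by (rule in_components_nonempty)
  then obtain x0 where x0: "x0 \<in> K" using K by blast
  have KE: "K \<subseteq> E m" using K(1) openin_imp_subset by blast
  obtain T where T: "open T" "K = E m \<inter> T" using K(1) by (auto simp: openin_open)
  have "closed (E m - K)"
  proof -
    have "E m - K = E m - T" using T by auto
    then show ?thesis using closed_E T(1) by (simp add: closed_Diff)
  qed
  then obtain d where d: "d > 0" "\<And>x y. x \<in> K \<Longrightarrow> y \<in> E m - K \<Longrightarrow> d \<le> dist x y"
    using separate_compact_closed[OF K(2), of "E m - K"] by auto
  define W where "W = (\<Union>x\<in>K. ball x (d / 2))"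
  have "open W" by (auto simp: W_def)
  have "K \<subseteq> W" using d by (force simp: W_def)
  have "bounded W"
  proof -
    obtain B where B: "\<And>x. x \<in> K \<Longrightarrow> norm x \<le> B"
      using compact_imp_bounded[OF K(2)] by (auto simp: bounded_iff)
    have "norm y \<le> B + d" if "y \<in> W" for y
    proof -
      obtain x where x: "x \<in> K" "dist x y < d / 2" using \<open>y \<in> W\<close> by (auto simp: W_def)
      then have "norm y \<le> norm x + dist x y" using norm_triangle_sub[of y x] by (simp add: dist_norm norm_minus_commute)
      then show ?thesis using x B[of x] d by linarith
    qed
    then show ?thesis by (auto simp: bounded_iff)
  qed
  have disj: "frontier W \<inter> E m = {}"
  proof (rule ccontr)
    assume "\<not> ?thesis"
    then obtain y where y: "y \<in> frontier W" "y \<in> E m" by auto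
    then have "y \<notin> W" "y \<in> closure W"
      using \<open>open W\<close> by (auto simp: frontier_def interior_open)
    then obtain w where w: "w \<in> W" "dist w y < d / 2"
      using d(1) by (meson closure_approachable half_gt_zero)
    then obtain x where x: "x \<in> K" "dist x w < d / 2" by (auto simp: W_def)
    have "dist x y < d" using dist_triangle[of x y w] w x by linarith
    moreover have "y \<in> E m - K" using y \<open>y \<notin> W\<close> \<open>K \<subseteq> W\<close> by auto
    ultimately show False using d(2)[OF x(1), of y] by linarith
  qed
  have cpt: "compact (frontier W)" using \<open>bounded W\<close> by (rule compact_frontier_bounded)
  obtain n where n: "n \<ge> 1" "\<And>z. z \<in> frontier W \<Longrightarrow> norm ((g ^^ n) z) < a (n + m)"
    using compact_below_level[OF cpt disj] by blast
  have "W \<noteq> {}" "W \<noteq> UNIV" using x0 \<open>K \<subseteq> W\<close> \<open>bounded W\<close> not_bounded_UNIV by auto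
  then have "frontier W \<noteq> {}" using frontier_eq_empty by blast
  then obtain \<xi> where \<xi>: "\<xi> \<in> frontier W" "\<And>z. z \<in> frontier W \<Longrightarrow> norm ((g ^^ n) z) \<le> norm ((g ^^ n) \<xi>)"
    using continuous_attains_sup[OF cpt _ continuous_iterate] by blast
  have "norm ((g ^^ n) x0) \<le> norm ((g ^^ n) \<xi>)"
  proof (rule maximum_modulus_frontier[of "g ^^ n" W])
    show "(g ^^ n) holomorphic_on interior W" using holomorphic_iterate holomorphic_on_subset by blast
    show "continuous_on (closure W) (g ^^ n)"
      using holomorphic_iterate holomorphic_on_imp_continuous_on continuous_on_subset by blast
  qed (use \<open>bounded W\<close> \<xi> x0 \<open>K \<subseteq> W\<close> in auto)
  then have "norm ((g ^^ n) x0) < a (n + m)" using n(2)[OF \<xi>(1)] by linarith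
  moreover have "x0 \<in> E m" using x0 KE by blast
  ultimately show False using n(1) by (auto simp: E_def not_less[symmetric])
qed

definition U :: "nat \<Rightarrow> complex set" where
  "U m = connected_component_set (- E m) 0"

lemma ball_subset_compl_E: "ball 0 (a m) \<subseteq> - E m"
proof
  fix z :: complex assume "z \<in> ball 0 (a m)"
  then have "norm ((g ^^ 1) z) < a (1 + m)" using norm_less_M[of z "a m"] by (simp add: a_Suc)
  then show "z \<in> - E m" unfolding E_def using not_less by blast
qed

lemma ball_subset_U: "ball 0 (a m) \<subseteq> U m"
  unfolding U_def by (rule connected_component_maximal) (use a_pos ball_subset_compl_E in auto)

lemma U_component: "U m \<in> components (- E m)"
  unfolding U_def by (rule componentsI) (use ball_subset_compl_E[of m] a_pos[of m] in \<open>auto simp: subset_iff\<close>)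

lemma U_mono: "U m \<subseteq> U (Suc m)"
proof -
  have "- E m \<subseteq> - E (Suc m)"
  proof -
    have "a (n + m) \<le> a (n + Suc m)" for n by (rule strict_mono_leD[OF strict_mono_a]) simp
    then have "E (Suc m) \<subseteq> E m" unfolding E_def by (blast intro: order_trans)
    then show ?thesis by blast
  qed
  then show ?thesis unfolding U_def by (rule connected_component_mono)
qed

text \<open>If \<open>U m\<close> reached the circle of radius \<open>\<rho> m\<close>, join 0 to
  that place by a path in \<open>U m\<close>. Orbits starting at 0 stay below the levels, so by the
  intermediate value theorem the image of the path under each iterate crosses the next circle, and
  the lower bound on it pushes the following image outwards. But some iterate maps the compact path
  below its level.\<close>

lemma U_bounded:
  assumes \<rho>: "\<And>n. n \<ge> m \<Longrightarrow> a n < \<rho> n"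
    and min: "\<And>n z. n \<ge> m \<Longrightarrow> norm z = \<rho> n \<Longrightarrow> \<rho> (Suc n) \<le> norm (g z)"
  shows "U m \<subseteq> ball 0 (\<rho> m)"
proof (rule ccontr)
  assume "\<not> ?thesis"
  then obtain w where "w \<in> U m" "w \<notin> ball 0 (\<rho> m)" by blast
  then have w: "w \<in> U m" "norm w \<ge> \<rho> m" by auto
  have "open (U m)" using open_components[OF _ U_component] closed_E by auto
  moreover have "connected (U m)" using in_components_connected[OF U_component] .
  ultimately have "path_connected (U m)" using connected_open_path_connected by blast
  moreover have "0 \<in> U m" using ball_subset_U a_pos by fastforce
  ultimately obtain p where p: "path p" "path_image p \<subseteq> U m" "pathstart p = 0" "pathfinish p = w"
    using w(1) unfolding path_connected_def by blast
  define P where "P = path_image p"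
  have P: "compact P" "connected P" "0 \<in> P" "w \<in> P"
    using p compact_path_image connected_path_image pathstart_in_path_image pathfinish_in_path_image
    unfolding P_def by metis+
  have "P \<inter> E m = {}" using p(2) in_components_subset[OF U_component] unfolding P_def by blast
  then obtain N where N: "\<And>z. z \<in> P \<Longrightarrow> norm ((g ^^ N) z) < a (N + m)"
    using compact_below_level[OF P(1)] by blast
  have zero: "norm ((g ^^ n) 0) < a (n + m)" for n
    by (rule iterate_below_mono[of 0]) (use a_pos in auto)
  have "\<exists>z\<in>P. norm ((g ^^ n) z) \<ge> \<rho> (n + m)" for n
  proof (induction n)
    case 0
    then show ?case using P w by auto
  next
    case (Suc n)
    then obtain z where z: "z \<in> P" "norm ((g ^^ n) z) \<ge> \<rho> (n + m)" by blast
    have "connected ((\<lambda>z. norm ((g ^^ n) z)) ` P)"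
      using P(2) continuous_iterate by (intro connected_continuous_image)
    moreover have "norm ((g ^^ n) 0) \<le> \<rho> (n + m)"
      using zero[of n] \<rho>[of "n + m"] by simp
    ultimately have "\<rho> (n + m) \<in> (\<lambda>z. norm ((g ^^ n) z)) ` P"
      using connectedD_interval[of "(\<lambda>z. norm ((g ^^ n) z)) ` P" "norm ((g ^^ n) 0)" "norm ((g ^^ n) z)" "\<rho> (n + m)"] z P by blast
    then obtain v where v: "v \<in> P" "norm ((g ^^ n) v) = \<rho> (n + m)" by auto
    then have "\<rho> (Suc (n + m)) \<le> norm (g ((g ^^ n) v))" by (intro min) auto
    then show ?case using v(1) by auto
  qed
  then obtain z where "z \<in> P" "norm ((g ^^ N) z) \<ge> \<rho> (N + m)" by blast
  then show False using N[of z] \<rho>[of "N + m"] by simp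
qed

text \<open>The frontier of each filled component lies in \<open>E 0\<close> and is connected.
  Components of \<open>E 0\<close> are unbounded, so those meeting \<open>G k\<close> also meet its
  frontier; any two points of \<open>E 0\<close> are joined through the frontier of a common
  \<open>G k\<close>.\<close>

theorem spiders_web_A_set:
  assumes \<rho>: "\<And>n. n \<ge> m0 \<Longrightarrow> a n < \<rho> n"
    and min: "\<And>n z. n \<ge> m0 \<Longrightarrow> norm z = \<rho> n \<Longrightarrow> \<rho> (Suc n) \<le> norm (g z)"
  shows "spiders_web (A_set R g)"
proof -
  \<comment> \<open>Taking the complement of the outside fills the holes, which yields simple
    connectivity; starting at \<open>m0\<close> makes \<open>U_bounded\<close> applicable.\<close>
  define G where "G k = - outside (U (m0 + k))" for k
  have bU: "bounded (U (m0 + k))" for k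
    using U_bounded[of "m0 + k" \<rho>] \<rho> min bounded_ball bounded_subset by (metis le_trans le_add1)
  have openU: "open (U m)" for m using open_components[OF _ U_component] closed_E by auto
  have conU: "connected (U m)" for m using in_components_connected[OF U_component] .
  have out: "outside (U (m0 + k)) \<in> components (- U (m0 + k))" for k
    using bU connected_outside[of "U (m0 + k)"] outside_bounded_nonempty[OF bU]
    by (simp add: outside_in_components)
  have openG: "open (G k)" for k
    using closed_components[OF _ out] openU by (simp add: G_def open_closed)
  have conG: "connected (G k)" for k
    unfolding G_def by (rule component_complement_connected[OF conU out])
  have UG: "U (m0 + k) \<subseteq> G k" for k
    using outside_no_overlap[of "U (m0 + k)"] unfolding G_def by blast
  have bG: "bounded (G k)" for k
    unfolding G_def by (rule cobounded_outside[OF bU])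
  have scG: "simply_connected (G k)" for k
    unfolding simply_connected_eq_unbounded_complement_components[OF openG]
  proof (intro conjI ballI conG)
    fix C assume "C \<in> components (- G k)"
    then have "C \<in> components (outside (U (m0 + k)))" by (simp add: G_def)
    then have "C = outside (U (m0 + k))"
      using in_components_connected[OF out] in_components_nonempty[OF out]
      by (metis connected_eq_connected_components_eq in_components_maximal in_components_nonempty in_components_subset order_refl subset_empty inf.absorb2)
    then show "\<not> bounded C" using unbounded_outside[OF bU] by simp
  qed
  have frG: "frontier (G k) \<subseteq> E 0" for k
  proof -
    have "frontier (G k) \<subseteq> frontier (U (m0 + k))"
      using frontier_of_components_subset[OF out] by (simp add: G_def frontier_complement)
    also have "\<dots> \<subseteq> E (m0 + k)"
      by (rule frontier_of_components_closed_complement[OF closed_E U_component])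
    finally show ?thesis using E_subset by blast
  qed
  have con_frG: "connected (frontier (G k))" for k
    using connected_frontier_component_complement[OF conU out] by (simp add: G_def frontier_complement)
  have monoG: "G k \<subseteq> G (Suc k)" for k
    using outside_mono[OF U_mono[of "m0 + k"]] by (auto simp: G_def)
  have exhaust: "\<exists>k. z \<in> G k" for z
  proof -
    have "\<forall>\<^sub>F n in sequentially. a n > norm z"
      using a_at_top by (simp add: filterlim_at_top_dense)
    then obtain n where "\<And>k. k \<ge> n \<Longrightarrow> a k > norm z" by (auto simp: eventually_sequentially)
    then have "z \<in> ball 0 (a (m0 + n))" by simp
    then show ?thesis using ball_subset_U UG by blast
  qed
  have meets: "C \<inter> frontier (G k) \<noteq> {}" if C: "C \<in> components (E 0)" and "C \<inter> G k \<noteq> {}" for C k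
  proof (rule connected_Int_frontier)
    show "connected C" using in_components_connected[OF C] .
    show "C - G k \<noteq> {}"
      using component_E_unbounded[OF C] bG[of k] bounded_subset by blast
  qed fact
  have monoG': "k \<le> k' \<Longrightarrow> G k \<subseteq> G k'" for k k'
    using lift_Suc_mono_le[of G] monoG by blast
  have "connected (E 0)"
    unfolding connected_iff_connected_component
  proof (intro ballI)
    fix x y assume x: "x \<in> E 0" and y: "y \<in> E 0"
    define Cx where "Cx = connected_component_set (E 0) x"
    define Cy where "Cy = connected_component_set (E 0) y"
    have C: "Cx \<in> components (E 0)" "Cy \<in> components (E 0)" "x \<in> Cx" "y \<in> Cy"
      using x y by (auto simp: Cx_def Cy_def components_def)
    obtain i j where "x \<in> G i" "y \<in> G j" using exhaust by metis
    then have "x \<in> G (max i j)" "y \<in> G (max i j)"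
      using monoG'[of i "max i j"] monoG'[of j "max i j"] by auto
    then obtain u v where u: "u \<in> Cx" "u \<in> frontier (G (max i j))" and v: "v \<in> Cy" "v \<in> frontier (G (max i j))"
      using meets[OF C(1), of "max i j"] meets[OF C(2), of "max i j"] C by blast
    have "connected_component (E 0) x u" "connected_component (E 0) y v"
      using u v by (simp_all add: Cx_def Cy_def)
    moreover have "connected_component (E 0) u v"
      by (rule connected_component_of_subset[OF _ frG]) (use con_frG u v in \<open>auto simp: connected_iff_connected_component\<close>)
    ultimately show "connected_component (E 0) x y"
      by (meson connected_component_sym connected_component_trans)
  qed
  then have "connected (A_set R g)" by (simp add: A_set_eq)
  moreover have "G n \<noteq> {}" for n
  proof -
    have "0 \<in> ball 0 (a (m0 + n))" using a_pos by simp
    then show ?thesis using ball_subset_U UG by blast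
  qed
  moreover have "(\<Union>n. G n) = UNIV" using exhaust by auto
  ultimately show ?thesis
    unfolding spiders_web_def A_set_eq using openG conG scG bG monoG frG
    by (intro conjI exI[of _ G] allI) auto
qed

end

subsection \<open>Log-regularity\<close>

context entire_function
begin

lemma M_pos: "r > 0 \<Longrightarrow> M r > 0"
  using M_strict_mono[of 0 r] M_nonneg[of 0] by auto

text \<open>In the coordinate w with z = exp w, multiply by \<open>exp (- m * w)\<close> with
  \<open>m\<close> the slope of the chord. Both edges of the strip then have the same bound
  \<open>B\<close>, and a larger value inside would be a maximum, making \<open>h\<close> constant
  and contradicting the bound on an edge.\<close>

lemma hadamard_three_circles: "convex_on UNIV (log_max_modulus g)"
proof (rule convex_on_linorderI)
  fix t x y :: real
  assume t: "0 < t" "t < 1" and xy: "x < y"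
  define \<phi> where "\<phi> = log_max_modulus g"
  have exp\<phi>: "exp (\<phi> u) = M (exp u)" for u
    using M_pos by (simp add: \<phi>_def log_max_modulus_def)
  define m where "m = (\<phi> y - \<phi> x) / (y - x)"
  define h where "h w = g (exp w) * exp (- of_real m * w)" for w
  define B where "B = exp (\<phi> x - m * x)"
  have "\<phi> y - m * y = \<phi> x - m * x"
    using xy by (simp add: m_def field_simps)
  then have B': "B = exp (\<phi> y - m * y)" by (simp add: B_def)
  have norm_h: "norm (h w) \<le> exp (\<phi> (Re w) - m * Re w)" for w
  proof -
    have "norm (h w) \<le> M (exp (Re w)) * exp (- m * Re w)"
      using norm_le_M[of "exp w"] by (simp add: h_def norm_mult mult_right_mono)
    then show ?thesis by (simp add: exp\<phi>[symmetric] exp_diff exp_minus divide_inverse)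
  qed
  \<comment> \<open>The maximum modulus on each vertical line is already attained for imaginary part
    within [- pi, pi]. The rectangle \<open>Q\<close> therefore suffices, although the strip is not
    compact and \<open>h\<close> itself need not be periodic.\<close>
  have attained: "\<exists>w. Re w = u \<and> \<bar>Im w\<bar> \<le> pi \<and> norm (h w) = exp (\<phi> u - m * u)" for u
  proof -
    obtain z where z: "norm z = exp u" "norm (g z) = M (exp u)" using M_attained[of "exp u"] by auto
    have "exp (Complex u (Arg z)) = z"
    proof -
      have "z = of_real (norm z) * exp (\<i> * of_real (Arg z))"
        by (rule Arg_eq) (use z in auto)
      also have "\<dots> = exp (of_real u + \<i> * of_real (Arg z))"
        unfolding z exp_add exp_of_real ..
      also have "of_real u + \<i> * of_real (Arg z) = Complex u (Arg z)" by (simp add: complex_eq_iff)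
      finally show ?thesis ..
    qed
    then have "norm (h (Complex u (Arg z))) = M (exp u) * exp (- m * u)"
      using z by (simp add: h_def norm_mult)
    moreover have "\<bar>Arg z\<bar> \<le> pi" using Arg_bounded[of z] by auto
    ultimately show ?thesis
      by (intro exI[of _ "Complex u (Arg z)"]) (simp add: exp\<phi>[symmetric] exp_diff exp_minus divide_inverse)
  qed
  have holh: "h holomorphic_on UNIV"
  proof -
    have "(g \<circ> exp) holomorphic_on UNIV"
      by (rule holomorphic_on_compose_gen[OF _ hol]) (auto intro!: holomorphic_intros)
    then show ?thesis unfolding h_def o_def by (intro holomorphic_intros)
  qed
  define u where "u = (1 - t) * x + t * y"
  have u: "x < u" "u < y"
  proof -
    have "u - x = t * (y - x)" "y - u = (1 - t) * (y - x)" by (simp_all add: u_def algebra_simps)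
    then show "x < u" "u < y" using t xy by (metis diff_gt_0_iff_gt mult_pos_pos)+
  qed
  have "exp (\<phi> u - m * u) \<le> B"
  proof (rule ccontr)
    assume "\<not> ?thesis"
    then have gt: "exp (\<phi> u - m * u) > B" by simp
    define Q where "Q = cbox (Complex x (- pi)) (Complex y pi)"
    have Q: "w \<in> Q \<longleftrightarrow> x \<le> Re w \<and> Re w \<le> y \<and> \<bar>Im w\<bar> \<le> pi" for w
      by (auto simp: Q_def in_cbox_complex_iff)
    have conth: "continuous_on Q (\<lambda>w. norm (h w))"
      using holh holomorphic_on_imp_continuous_on continuous_on_subset continuous_on_norm by blast
    obtain w1 where w1: "Re w1 = u" "\<bar>Im w1\<bar> \<le> pi" "norm (h w1) = exp (\<phi> u - m * u)"
      using attained by blast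
    have "Q \<noteq> {}" using w1 u Q by (metis empty_iff less_imp_le)
    then obtain w0 where w0: "w0 \<in> Q" "\<And>w. w \<in> Q \<Longrightarrow> norm (h w) \<le> norm (h w0)"
      using continuous_attains_sup[OF _ _ conth] Q_def compact_cbox by blast
    have big: "norm (h w0) > B" using w0(2)[of w1] w1 u gt Q by auto
    have "Re w0 \<noteq> x" using norm_h[of w0] big by (auto simp: B_def)
    moreover have "Re w0 \<noteq> y" using norm_h[of w0] big by (auto simp: B')
    ultimately have Re0: "x < Re w0" "Re w0 < y" using w0(1) Q by auto
    have "h constant_on UNIV"
    proof (rule maximum_modulus_principle[OF holh, of "{w. x < Re w \<and> Re w < y}" w0])
      show "open {w. x < Re w \<and> Re w < y}"
        using open_Int[OF open_halfspace_Re_gt[of x] open_halfspace_Re_lt[of y]] by (simp add: Collect_conj_eq)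
      fix w assume w: "w \<in> {w. x < Re w \<and> Re w < y}"
      obtain w' where "Re w' = Re w" "\<bar>Im w'\<bar> \<le> pi" "norm (h w') = exp (\<phi> (Re w) - m * Re w)"
        using attained by blast
      then show "norm (h w) \<le> norm (h w0)"
        using norm_h[of w] w0(2)[of w'] w Q by auto
    qed (use Re0 in auto)
    then have "h w0 = h (of_real x)" unfolding constant_on_def by auto
    then show False using norm_h[of "of_real x"] big by (simp add: B_def)
  qed
  then have "\<phi> u \<le> \<phi> x + m * (u - x)" by (simp add: B_def algebra_simps)
  also have "m * (u - x) = t * (\<phi> y - \<phi> x)"
    using xy by (simp add: m_def u_def field_simps)
  finally show "log_max_modulus g ((1 - t) *\<^sub>R x + t *\<^sub>R y) \<le> (1 - t) * log_max_modulus g x + t * log_max_modulus g y"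
    by (simp add: u_def \<phi>_def algebra_simps)
qed auto

end

section \<open>Right derivatives of convex functions\<close>

lemma convex_slope_mono:
  fixes \<phi> :: "real \<Rightarrow> real"
  assumes "convex_on UNIV \<phi>" "t < v" "v \<le> u"
  shows "(\<phi> v - \<phi> t) / (v - t) \<le> (\<phi> u - \<phi> t) / (u - t)"
proof (cases "v = u")
  case False
  then have "v \<in> {t<..<u}" using assms by auto
  then show ?thesis
    using convex_on_slope_le(1)[of UNIV \<phi> t u v] assms(1)
      minus_divide_divide[of "\<phi> v - \<phi> t" "v - t"] minus_divide_divide[of "\<phi> u - \<phi> t" "u - t"]
    by simp
qed simp

lemma convex_right_derivative_le:
  fixes \<phi> :: "real \<Rightarrow> real"
  assumes cv: "convex_on UNIV \<phi>" and D: "(\<phi> has_real_derivative D) (at_right t)" and u: "t < u"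
  shows "D \<le> (\<phi> u - \<phi> t) / (u - t)"
proof (rule tendsto_upperbound)
  show "((\<lambda>v. (\<phi> v - \<phi> t) / (v - t)) \<longlongrightarrow> D) (at_right t)"
    using D by (simp add: has_field_derivative_iff)
  show "\<forall>\<^sub>F v in at_right t. (\<phi> v - \<phi> t) / (v - t) \<le> (\<phi> u - \<phi> t) / (u - t)"
    unfolding eventually_at_right_field using u convex_slope_mono[OF cv] by (auto intro!: exI[of _ u])
qed simp

text \<open>The right derivative is the infimum of the slopes to the right, which are bounded below
  by every slope to the left.\<close>

lemma convex_right_derivative_exists:
  fixes \<phi> :: "real \<Rightarrow> real"
  assumes cv: "convex_on UNIV \<phi>"
  shows "\<exists>D. (\<phi> has_real_derivative D) (at_right t) \<and> (\<forall>s<t. (\<phi> t - \<phi> s) / (t - s) \<le> D)"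
proof -
  define q where "q u = (\<phi> u - \<phi> t) / (u - t)" for u
  have lower: "(\<phi> t - \<phi> s) / (t - s) \<le> q u" if "s < t" "t < u" for s u
  proof -
    have "(\<phi> t - \<phi> s) / (t - s) \<le> (\<phi> u - \<phi> s) / (u - s)"
      using that by (intro convex_slope_mono[OF cv]) auto
    then have "(\<phi> t - \<phi> s) * (u - s) \<le> (\<phi> u - \<phi> s) * (t - s)" using that by (simp add: divide_simps)
    then have "(\<phi> t - \<phi> s) * (u - t) \<le> (\<phi> u - \<phi> t) * (t - s)" by (simp add: algebra_simps)
    then show ?thesis using that by (simp add: q_def divide_simps)
  qed
  have bdd: "bdd_below (q ` {t<..})"
    by (rule bdd_belowI[of _ "(\<phi> t - \<phi> (t - 1)) / (t - (t - 1))"]) (use lower[of "t - 1"] in auto)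
  define D where "D = Inf (q ` {t<..})"
  have D_le: "D \<le> q u" if "u > t" for u
    unfolding D_def using bdd that by (intro cInf_lower) auto
  have "(q \<longlongrightarrow> D) (at_right t)"
  proof (rule order_tendstoI)
    fix x assume "x < D"
    then show "\<forall>\<^sub>F u in at_right t. x < q u"
      unfolding eventually_at_right_field using D_le by (intro exI[of _ "t + 1"]) force
  next
    fix x assume "D < x"
    then obtain u0 where u0: "u0 > t" "q u0 < x"
      unfolding D_def using bdd by (subst (asm) cInf_less_iff) auto
    have "q u < x" if "t < u" "u < u0" for u
      using convex_slope_mono[OF cv, of t u u0] that u0 by (simp add: q_def)
    then show "\<forall>\<^sub>F u in at_right t. q u < x"
      unfolding eventually_at_right_field using u0 by blast
  qed
  then have "(\<phi> has_real_derivative D) (at_right t)"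
    by (simp add: has_field_derivative_iff q_def[abs_def])
  moreover have "(\<phi> t - \<phi> s) / (t - s) \<le> D" if "s < t" for s
    unfolding D_def by (rule cInf_greatest) (use lower[OF that] in auto)
  ultimately show ?thesis by blast
qed

text \<open>The integrated form of log-regularity, which is insensitive to bounded changes of \<open>\<phi>\<close> and
  to rescaling of the argument.\<close>

definition superlinear :: "(real \<Rightarrow> real) \<Rightarrow> bool" where
  "superlinear \<phi> \<longleftrightarrow> (\<forall>A>0. \<exists>K>1. \<forall>\<^sub>F t in at_top. A * K * \<phi> t \<le> \<phi> (K * t))"

text \<open>Iterating the inequality replaces \<open>K\<close> by its powers and \<open>d\<close> by
  the same powers of \<open>d\<close>, which exceed any given \<open>A\<close>.\<close>

lemma superlinearI:
  assumes K: "K > 1" and d: "d > 1" and pos: "\<forall>\<^sub>F t in at_top. \<phi> t > 0"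
    and ev: "\<forall>\<^sub>F t in at_top. d * K * \<phi> t \<le> \<phi> (K * t)"
  shows "superlinear \<phi>"
  unfolding superlinear_def
proof (intro allI impI)
  fix A :: real assume "A > 0"
  obtain j where j: "A < d ^ j" using real_arch_pow[OF d] by blast
  have "\<forall>\<^sub>F t in at_top. d ^ i * K ^ i * \<phi> t \<le> \<phi> (K ^ i * t)" for i
  proof (induction i)
    case (Suc i)
    have "filterlim (\<lambda>t. K ^ i * t) at_top at_top"
      using K by (intro filterlim_tendsto_pos_mult_at_top[OF tendsto_const]) (auto intro: filterlim_ident)
    from Suc eventually_compose_filterlim[OF ev this] show ?case
    proof eventually_elim
      case (elim t)
      have "d ^ Suc i * K ^ Suc i * \<phi> t = d * K * (d ^ i * K ^ i * \<phi> t)" by simp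
      also have "\<dots> \<le> d * K * \<phi> (K ^ i * t)" using elim(1) d K by (intro mult_left_mono) auto
      also have "\<dots> \<le> \<phi> (K * (K ^ i * t))" by (rule elim(2))
      finally show ?case by (simp add: mult.assoc)
    qed
  qed simp
  from this[of "Suc j"] pos have "\<forall>\<^sub>F t in at_top. A * K ^ Suc j * \<phi> t \<le> \<phi> (K ^ Suc j * t)"
  proof eventually_elim
    case (elim t)
    have "d ^ j \<le> d ^ Suc j" using d by (intro power_increasing) auto
    then have "A * (K ^ Suc j * \<phi> t) \<le> d ^ Suc j * (K ^ Suc j * \<phi> t)"
      using j K elim by (intro mult_right_mono) auto
    then show ?case using elim by (simp add: mult.assoc)
  qed
  moreover have "K ^ Suc j > 1" using K by (rule one_less_power) simp
  ultimately show "\<exists>K>1. \<forall>\<^sub>F t in at_top. A * K * \<phi> t \<le> \<phi> (K * t)" by blast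
qed

lemma superlinear_transfer:
  assumes sup: "superlinear \<phi>" and top: "filterlim \<phi> at_top at_top" and m: "m \<ge> 1"
    and 1: "\<forall>\<^sub>F t in at_top. \<phi> t \<le> \<psi> (m * t) + C" and 2: "\<forall>\<^sub>F t in at_top. \<psi> t \<le> \<phi> t + C"
  shows "superlinear \<psi>"
  unfolding superlinear_def
proof (intro allI impI)
  fix A :: real assume A: "A > 0"
  \<comment> \<open>The factor \<open>m\<close> is needed because \<open>\<psi>\<close> is compared
    at \<open>m * K * t\<close>; the 2 leaves a spare multiple of \<open>\<phi> t\<close>, which
    tends to infinity and absorbs the constants \<open>C\<close>.\<close>
  then have "2 * m * A > 0" using m by simp
  then obtain K where K: "K > 1" "\<forall>\<^sub>F t in at_top. 2 * m * A * K * \<phi> t \<le> \<phi> (K * t)"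
    using sup unfolding superlinear_def by blast
  have "filterlim (\<lambda>t. K * t) at_top at_top"
    using K by (intro filterlim_tendsto_pos_mult_at_top[OF tendsto_const]) (auto intro: filterlim_ident)
  from eventually_compose_filterlim[OF 1 this] K(2) 2
  have "\<forall>\<^sub>F t in at_top. A * (m * K) * \<psi> t \<le> \<psi> (m * K * t)"
    using filterlim_at_top[THEN iffD1, OF top, rule_format, of "(C + A * (m * K) * C) / (A * (m * K))"]
  proof eventually_elim
    case (elim t)
    define P where "P = A * (m * K)"
    have P: "P > 0" using A m K by (simp add: P_def)
    have "P * \<psi> t \<le> P * (\<phi> t + C)" using elim(3) P by (intro mult_left_mono) auto
    moreover have "C + P * C \<le> P * \<phi> t" using elim(4) unfolding P_def[symmetric] pos_divide_le_eq[OF P] by (simp add: mult.commute)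
    moreover have "2 * P * \<phi> t \<le> \<phi> (K * t)" using elim(2) by (simp add: P_def mult_ac)
    moreover have "\<phi> (K * t) \<le> \<psi> (m * K * t) + C" using elim(1) by (simp add: mult.assoc)
    ultimately show ?case unfolding P_def[symmetric] by (simp add: distrib_left)
  qed
  moreover have "m * K > 1" using m K mult_le_less_imp_less[of 1 m 1 K] by simp
  ultimately show "\<exists>K>1. \<forall>\<^sub>F t in at_top. A * K * \<psi> t \<le> \<psi> (K * t)" by blast
qed

context entire_function
begin

text \<open>By convexity \<phi>(2 t) - \<phi>(t) is at least t times the right derivative at
  \<open>t\<close>, hence at least (1 + c) \<phi>(t). This gives \<phi>(2 t) \<ge> (2 + c)
  \<phi>(t).\<close>

lemma log_regular_imp_superlinear:
  assumes reg: "log_regular_with c g" and c: "c > 0"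
    and top: "filterlim (log_max_modulus g) at_top at_top"
  shows "superlinear (log_max_modulus g)"
proof (rule superlinearI[of 2 "1 + c / 2"])
  show pos: "\<forall>\<^sub>F t in at_top. log_max_modulus g t > 0"
    using top by (simp add: filterlim_at_top_dense)
  have "\<forall>\<^sub>F t in at_top. \<exists>D. (log_max_modulus g has_real_derivative D) (at_right t) \<and>
        D / log_max_modulus g t \<ge> (1 + c) / t"
    using reg by (simp add: log_regular_with_def)
  then show "\<forall>\<^sub>F t in at_top. (1 + c / 2) * 2 * log_max_modulus g t \<le> log_max_modulus g (2 * t)"
    using pos eventually_gt_at_top[of 0]
  proof eventually_elim
    case (elim t)
    then obtain D where D: "(log_max_modulus g has_real_derivative D) (at_right t)"
      "D / log_max_modulus g t \<ge> (1 + c) / t" by blast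
    have "(1 + c) * log_max_modulus g t \<le> D * t"
      using D(2) elim by (simp add: divide_simps)
    also have "D \<le> (log_max_modulus g (2 * t) - log_max_modulus g t) / (2 * t - t)"
      by (rule convex_right_derivative_le[OF hadamard_three_circles D(1)]) (use elim in simp)
    then have "D * t \<le> log_max_modulus g (2 * t) - log_max_modulus g t"
      using elim by (simp add: divide_simps)
    finally show ?case by (simp add: algebra_simps)
  qed
qed (use c in auto)

text \<open>The right derivative at \<open>t\<close> is at least the slope over [t / K, t], where
  \<phi>(t / K) \<le> \<phi>(t) / (2 K). The constant \<open>c\<close> solves (1 - 1 / (2 K)) / (1 -
  1 / K) = 1 + c.\<close>

lemma superlinear_imp_log_regular:
  assumes tr: "transcendental_entire g" and sup: "superlinear (log_max_modulus g)"
    and top: "filterlim (log_max_modulus g) at_top at_top"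
  shows "log_regular g"
proof -
  define \<phi> where "\<phi> = log_max_modulus g"
  obtain K where K: "K > 1" "\<forall>\<^sub>F t in at_top. 2 * K * \<phi> t \<le> \<phi> (K * t)"
    using sup unfolding superlinear_def \<phi>_def by (meson zero_less_numeral)
  define c where "c = 1 / (2 * (K - 1))"
  have c: "c > 0" using K by (simp add: c_def)
  have "filterlim (\<lambda>t. (1 / K) * t) at_top at_top"
    using K by (intro filterlim_tendsto_pos_mult_at_top[OF tendsto_const]) (auto intro: filterlim_ident)
  from eventually_compose_filterlim[OF K(2) this]
  have "\<forall>\<^sub>F t in at_top. 2 * K * \<phi> (t / K) \<le> \<phi> t" using K by simp
  moreover have "\<forall>\<^sub>F t in at_top. \<phi> t > 0"
    using top by (simp add: filterlim_at_top_dense \<phi>_def)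
  ultimately have "\<forall>\<^sub>F t in at_top. \<exists>D. (\<phi> has_real_derivative D) (at_right t) \<and> D / \<phi> t \<ge> (1 + c) / t"
    using eventually_gt_at_top[of 0]
  proof eventually_elim
    case (elim t)
    obtain D where D: "(\<phi> has_real_derivative D) (at_right t)" "\<And>s. s < t \<Longrightarrow> (\<phi> t - \<phi> s) / (t - s) \<le> D"
      using convex_right_derivative_exists[OF hadamard_three_circles, of t] unfolding \<phi>_def by blast
    have tK: "t / K < t" using K elim by (simp add: divide_less_eq)
    have "(1 + c) / t = (1 - 1 / (2 * K)) / (t - t / K)"
      using K elim by (simp add: c_def divide_simps) (simp add: algebra_simps)
    also have "\<dots> * \<phi> t = (\<phi> t - \<phi> t / (2 * K)) / (t - t / K)" by (simp add: algebra_simps)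
    also have "\<dots> \<le> (\<phi> t - \<phi> (t / K)) / (t - t / K)"
    proof (rule divide_right_mono)
      show "\<phi> t - \<phi> t / (2 * K) \<le> \<phi> t - \<phi> (t / K)"
        using elim(1) K by (simp add: le_divide_eq mult.commute)
    qed (use tK in simp)
    also have "\<dots> \<le> D" by (rule D(2)[OF tK])
    finally have "(1 + c) / t \<le> D / \<phi> t" using elim(2) by (simp add: le_divide_eq)
    then show ?case using D(1) by blast
  qed
  then show ?thesis
    unfolding log_regular_def log_regular_with_def \<phi>_def using c tr by blast
qed

end

section \<open>Maximum modulus compared with the majorant\<close>

lemma max_modulus_le_abs_series:
  assumes sums: "\<And>z. (\<lambda>k. c k * z ^ l k) sums h z" and l: "strict_mono l" and r: "r \<ge> 0"
  shows "max_modulus r h \<le> abs_series c l r"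
  unfolding max_modulus_def
proof (rule cSUP_least)
  show "sphere (0::complex) r \<noteq> {}" using r by simp
  fix z :: complex assume "z \<in> sphere 0 r"
  then have z: "norm z = r" by simp
  have "h z = (\<Sum>k. c k * z ^ l k)" using sums by (simp add: sums_iff)
  also have "norm \<dots> \<le> (\<Sum>k. norm (c k * z ^ l k))"
    by (rule summable_norm)
       (use norm_summable_of_power_series[OF sums l, of r] in \<open>simp add: norm_mult norm_power z\<close>)
  finally show "norm (h z) \<le> abs_series c l r"
    by (simp add: abs_series_def norm_mult norm_power z)
qed

lemma term_le_abs_series:
  assumes sums: "\<And>z. (\<lambda>k. c k * z ^ l k) sums h z" and l: "strict_mono l" and r: "r \<ge> 0"
  shows "norm (c k) * r ^ l k \<le> abs_series c l r"
  unfolding abs_series_def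
  using sum_le_suminf[OF norm_summable_of_power_series[OF sums l, of r], of "{k}"] r by simp

text \<open>On the positive axis majorant and function differ only in the terms before
  \<open>k0\<close>. These have lower degree than the term with index \<open>k0\<close>, so for
  large radii they amount to at most half of it.\<close>

lemma abs_series_le_max_modulus:
  assumes sums: "\<And>z. (\<lambda>k. c k * z ^ l k) sums h z" and l: "strict_mono l"
    and cont: "continuous_on UNIV h"
    and real: "\<And>k. k \<ge> k0 \<Longrightarrow> c k \<in> \<real>" and pos: "\<And>k. k \<ge> k0 \<Longrightarrow> 0 < Re (c k)"
  shows "\<forall>\<^sub>F r in at_top. abs_series c l r \<le> 2 * max_modulus r h"
proof -
  have eq: "of_real (norm (c k)) = c k" if "k \<ge> k0" for k
    using real[OF that] pos[OF that] by (auto simp: complex_eq_iff complex_is_Real_iff cmod_eq_Re)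
  define C where "C = (\<Sum>k<k0. 2 * norm (c k))"
  have c0: "norm (c k0) > 0" using pos[of k0] by auto
  show ?thesis using eventually_ge_at_top[of 1] eventually_ge_at_top[of "2 * C / norm (c k0)"]
  proof eventually_elim
    case (elim r)
    define z where "z = complex_of_real r"
    have "(\<lambda>k. of_real (norm (c k) * r ^ l k)) sums (of_real (abs_series c l r) :: complex)"
      unfolding sums_of_real_iff abs_series_def
      by (rule summable_sums[OF norm_summable_of_power_series[OF sums l]])
    from sums_diff[OF this sums[of z]]
    have "(\<lambda>k. (of_real (norm (c k)) - c k) * z ^ l k) sums (of_real (abs_series c l r) - h z)"
      by (simp add: z_def algebra_simps)
    moreover have "(\<lambda>k. (of_real (norm (c k)) - c k) * z ^ l k) sums (\<Sum>k<k0. (of_real (norm (c k)) - c k) * z ^ l k)"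
      by (rule sums_finite) (auto simp: eq)
    ultimately have "of_real (abs_series c l r) - h z = (\<Sum>k<k0. (of_real (norm (c k)) - c k) * z ^ l k)"
      by (rule sums_unique2)
    also have "norm \<dots> \<le> (\<Sum>k<k0. 2 * norm (c k) * (r ^ l k0 / r))"
    proof (rule sum_norm_le)
      fix k assume "k \<in> {..<k0}"
      then have "Suc (l k) \<le> l k0" using strict_monoD[OF l, of k k0] by simp
      then have "r ^ Suc (l k) \<le> r ^ l k0" using elim by (intro power_increasing) auto
      then have "r ^ l k \<le> r ^ l k0 / r" using elim by (simp add: le_divide_eq mult.commute)
      moreover have "norm (of_real (norm (c k)) - c k) \<le> 2 * norm (c k)"
        using norm_triangle_ineq4[of "of_real (norm (c k))" "c k"] by simp
      ultimately show "norm ((of_real (norm (c k)) - c k) * z ^ l k) \<le> 2 * norm (c k) * (r ^ l k0 / r)"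
        unfolding norm_mult norm_power z_def using elim by (intro mult_mono) auto
    qed
    also have "\<dots> = (C / r) * r ^ l k0" by (simp add: C_def sum_distrib_right sum_divide_distrib mult.assoc)
    also have "\<dots> \<le> (norm (c k0) / 2) * r ^ l k0"
      using elim c0 by (intro mult_right_mono) (auto simp: divide_simps mult.commute)
    also have "\<dots> \<le> abs_series c l r / 2"
      using term_le_abs_series[OF sums l, of r k0] elim by simp
    finally have "norm (of_real (abs_series c l r) - h z) \<le> abs_series c l r / 2" .
    moreover have "abs_series c l r \<ge> 0"
      using term_le_abs_series[OF sums l, of r k0] elim by (meson mult_nonneg_nonneg norm_ge_zero order_trans zero_le_one zero_le_power)
    moreover have "norm (h z) \<le> max_modulus r h"
    proof -
      have "continuous_on (sphere 0 r) h" using cont continuous_on_subset by blast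
      from max_modulus_attained[OF this] elim show ?thesis by (force simp: z_def)
    qed
    ultimately show ?case
      using norm_triangle_ineq2[of "of_real (abs_series c l r)" "h z"] by simp
  qed
qed

lemma abs_series_at_top:
  assumes sums: "\<And>z. (\<lambda>k. c k * z ^ l k) sums h z" and l: "strict_mono l" and c: "c k \<noteq> 0" "k \<ge> 1"
  shows "filterlim (\<lambda>r. abs_series c l r) at_top at_top"
proof (rule filterlim_at_top_mono)
  have "l k \<ge> 1" using strict_mono_imp_increasing[OF l, of k] c by simp
  show "filterlim (\<lambda>r. norm (c k) * r) at_top at_top"
    using c by (intro filterlim_tendsto_pos_mult_at_top[OF tendsto_const]) (auto intro: filterlim_ident)
  show "\<forall>\<^sub>F r in at_top. norm (c k) * r \<le> abs_series c l r"
    using eventually_ge_at_top[of 1]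
  proof eventually_elim
    case (elim r)
    have "norm (c k) * r ^ 1 \<le> norm (c k) * r ^ l k"
      using elim \<open>l k \<ge> 1\<close> by (intro mult_left_mono power_increasing) auto
    also have "\<dots> \<le> abs_series c l r" by (rule term_le_abs_series[OF sums l]) (use elim in simp)
    finally show ?case by simp
  qed
qed

text \<open>With \<open>n\<^sub>k \<le> i < n\<^sub>k\<^sub>+\<^sub>1\<close>, monotonicity gives \<open>a\<^sub>i (2r)\<^sup>i \<le> a\<^sub>n\<^sub>k ((2r)\<^sup>M)\<^sup>n\<^sup>k\<close>; the factor \<open>2\<^sup>i\<close> makes the sum over \<open>i\<close> converge.\<close>

lemma abs_series_le_subseries:
  fixes a :: "nat \<Rightarrow> complex" and l :: "nat \<Rightarrow> nat" and M :: real
  assumes f: "\<And>z. (\<lambda>i. a i * z ^ i) sums f z"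
    and g: "\<And>z. (\<lambda>k. a (l k) * z ^ l k) sums g z" and l: "strict_mono l"
    and M: "M \<ge> 1"
    and ratio: "\<And>k. k \<ge> k0 \<Longrightarrow> real (l (Suc k)) \<le> M * real (l k)"
    and decr: "\<And>i j. l k0 \<le> i \<Longrightarrow> i \<le> j \<Longrightarrow> norm (a j) \<le> norm (a i)"
    and nz: "a (l k0) \<noteq> 0"
  shows "\<exists>C\<ge>1. \<forall>r\<ge>2. abs_series a (\<lambda>i. i) r \<le> C * abs_series (\<lambda>k. a (l k)) l (r powr (2 * M))"
proof -
  note sumf = norm_summable_of_power_series[where l = "\<lambda>i. i", OF f]
  define b where "b = norm (a (l k0))"
  have b: "b > 0" using nz by (simp add: b_def)
  \<comment> \<open>The sum pays for the finitely many coefficients before \<open>l k0\<close>, each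
    measured against the term of degree \<open>l k0\<close> in the subseries.\<close>
  define C where "C = 1 + (\<Sum>i<l k0. 2 ^ i * norm (a i) / b)"
  have C: "C \<ge> 1" using b by (simp add: C_def sum_nonneg)
  have "abs_series a (\<lambda>i. i) r \<le> 2 * C * abs_series (\<lambda>k. a (l k)) l (r powr (2 * M))" if r: "r \<ge> 2" for r
  proof -
    define s where "s = r powr (2 * M)"
    define S where "S = abs_series (\<lambda>k. a (l k)) l s"
    have "r powr 1 \<le> s" unfolding s_def using r M by (intro powr_mono) auto
    then have s: "s \<ge> r" "s \<ge> 0" using r by auto
    have term_g: "norm (a (l k)) * s ^ l k \<le> S" for k
      unfolding S_def by (rule term_le_abs_series[OF g l s(2)])
    have S: "S \<ge> 0" using term_g[of 0] s by (meson mult_nonneg_nonneg norm_ge_zero order_trans zero_le_power)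
    have "norm (a i) * r ^ i \<le> C * S * (1 / 2) ^ i" for i
    proof (cases "i < l k0")
      case True
      have "2 ^ i * norm (a i) / b \<le> (\<Sum>i<l k0. 2 ^ i * norm (a i) / b)"
        by (rule member_le_sum) (use True b in auto)
      then have "norm (a i) * 2 ^ i \<le> C * b" using b by (simp add: C_def divide_simps mult.commute algebra_simps)
      moreover have "r ^ i \<le> s ^ l k0"
      proof -
        have "r ^ i \<le> r ^ l k0" using r True by (intro power_increasing) auto
        also have "\<dots> \<le> s ^ l k0" using r s by (intro power_mono) auto
        finally show ?thesis .
      qed
      ultimately have "(norm (a i) * 2 ^ i) * r ^ i \<le> (C * b) * s ^ l k0"
        by (rule mult_mono) (use C b r in auto)
      also have "\<dots> = C * (b * s ^ l k0)" by simp
      also have "\<dots> \<le> C * S"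
        using term_g[of k0] C by (intro mult_left_mono) (auto simp: b_def)
      finally show ?thesis by (simp add: power_divide le_divide_eq mult_ac)
    next
      case False
      define k where "k = Max {k. l k \<le> i}"
      have "{k. l k \<le> i} \<subseteq> {..i}" using strict_mono_imp_increasing[OF l] by (auto intro: order_trans)
      then have fin: "finite {k. l k \<le> i}" by (rule finite_subset) simp
      have "k0 \<in> {k. l k \<le> i}" using False by simp
      then have k: "l k \<le> i" "k \<ge> k0"
        using Max_in[OF fin] Max_ge[OF fin] unfolding k_def by blast+
      have "\<not> l (Suc k) \<le> i" using Max_ge[OF fin, of "Suc k"] unfolding k_def by auto
      then have "real i \<le> real (l (Suc k))" by simp
      also have "\<dots> \<le> M * real (l k)" by (rule ratio[OF k(2)])
      finally have iM: "real i \<le> M * real (l k)" .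
      have "(2 * r) ^ i = (2 * r) powr real i" using r by (simp add: powr_realpow)
      also have "\<dots> \<le> (2 * r) powr (M * real (l k))" using r iM by (intro powr_mono) auto
      \<comment> \<open>For r \<ge> 2 the spare factor 2 is absorbed by 2 r \<le> r^2, which turns
        the exponent \<open>M\<close> into \<open>2 * M\<close>.\<close>
      also have "\<dots> \<le> (r powr 2) powr (M * real (l k))"
        using r M by (intro powr_mono2) (auto simp: power2_eq_square)
      also have "\<dots> = s powr real (l k)" by (simp add: s_def powr_powr mult.assoc)
      also have "\<dots> = s ^ l k" using s r by (simp add: powr_realpow)
      finally have pw: "(2 * r) ^ i \<le> s ^ l k" .
      have "l k0 \<le> l k" using strict_mono_less_eq[OF l] k by simp
      then have "norm (a i) * (2 * r) ^ i \<le> norm (a (l k)) * s ^ l k"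
        using decr[of "l k" i] k pw r by (intro mult_mono) auto
      also have "\<dots> \<le> S" by (rule term_g)
      also have "\<dots> \<le> C * S" using C S mult_right_mono[of 1 C S] by simp
      finally show ?thesis by (simp add: power_divide power_mult_distrib le_divide_eq mult_ac)
    qed
    then have "abs_series a (\<lambda>i. i) r \<le> (\<Sum>i. C * S * (1 / 2) ^ i)"
      unfolding abs_series_def
      by (intro suminf_le sumf summable_mult summable_geometric strict_monoI) auto
    also have "\<dots> = C * S * 2"
      using suminf_mult[OF summable_geometric[of "1 / 2 :: real"], of "C * S"] suminf_geometric[of "1 / 2 :: real"] by simp
    finally show ?thesis by (simp add: S_def s_def mult_ac)
  qed
  then show ?thesis using C by (intro exI[of _ "2 * C"]) auto
qed

lemma superlinear_scale:
  assumes "superlinear \<phi>" "A > 0"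
  shows "\<exists>K>1. \<forall>\<^sub>F t in at_top. A * K * \<phi> t \<le> \<phi> (K * t)"
  using assms unfolding superlinear_def by blast

context escaping
begin

text \<open>Superlinearity is used twice. With \<open>K\<close> it undoes the square root: \<phi>(K
  T) \<ge> 2 \<phi>(T). With \<open>p\<close> it lets the radii continue: for t_n between p ln a_n
  and s p ln a_n, the minimum modulus is at least exp of \<phi>(p ln a_n) \<ge> s p \<phi>(ln a_n) =
  s p ln a_(n+1) \<ge> t_(n+1).\<close>

lemma spiders_web_of_min_modulus:
  assumes sup: "superlinear (log_max_modulus g)"
    and top: "filterlim (log_max_modulus g) at_top at_top"
    and min: "\<forall>\<^sub>F T in at_top. \<exists>t. T \<le> t \<and> t \<le> T + 2 \<and>
       (\<forall>z. norm z = exp t \<longrightarrow> sqrt (M (exp T)) \<le> norm (g z))"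
  shows "spiders_web (A_set R g)"
proof -
  define \<phi> where "\<phi> = log_max_modulus g"
  have exp\<phi>: "exp (\<phi> u) = M (exp u)" for u
    using M_pos by (simp add: \<phi>_def log_max_modulus_def)
  obtain K where K: "K > 1" "\<forall>\<^sub>F t in at_top. 2 * K * \<phi> t \<le> \<phi> (K * t)"
    using superlinear_scale[OF sup, of 2] unfolding \<phi>_def by auto
  have K0: "K > 0" using K(1) by simp
  \<comment> \<open>For T \<ge> 2 the window [K T, K T + 2] of the minimum modulus estimate lies
    below (K + 1) T.\<close>
  define s where "s = K + 1"
  have pos: "\<forall>\<^sub>F t in at_top. \<phi> t > 0"
    using top by (simp add: filterlim_at_top_dense \<phi>_def)
  have scale: "filterlim (\<lambda>t. c * t) at_top at_top" if "c > 0" for c :: real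
    using that by (intro filterlim_tendsto_pos_mult_at_top[OF tendsto_const]) (auto intro: filterlim_ident)
  have "\<forall>\<^sub>F T in at_top. \<exists>t. T \<le> t \<and> t \<le> s * T \<and> (\<forall>z. norm z = exp t \<longrightarrow> exp (\<phi> T) \<le> norm (g z))"
    using eventually_compose_filterlim[OF min scale[OF K0]] K(2) pos eventually_ge_at_top[of 2]
  proof eventually_elim
    case (elim T)
    then obtain t where t: "K * T \<le> t" "t \<le> K * T + 2"
      "\<And>z. norm z = exp t \<Longrightarrow> sqrt (M (exp (K * T))) \<le> norm (g z)"
      using K(1) by auto
    have "1 * T \<le> K * T" using K(1) elim by (intro mult_right_mono) auto
    then have "T \<le> t" using t(1) by simp
    moreover have "t \<le> s * T" using t(2) elim(4) by (simp add: s_def algebra_simps)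
    moreover have "exp (\<phi> T) \<le> norm (g z)" if z: "norm z = exp t" for z
    proof -
      have "1 * (2 * \<phi> T) \<le> K * (2 * \<phi> T)" using K(1) elim by (intro mult_right_mono) auto
      also have "\<dots> \<le> \<phi> (K * T)" using elim(2) by (simp add: mult_ac)
      finally have "2 * \<phi> T \<le> \<phi> (K * T)" by simp
      then have "exp (\<phi> T) \<le> exp (\<phi> (K * T) / 2)" by simp
      also have "\<dots> = sqrt (exp (\<phi> (K * T)))" by (rule real_sqrt_unique[symmetric]) (simp_all flip: exp_of_nat_mult)
      also have "\<dots> \<le> norm (g z)" unfolding exp\<phi> by (rule t(3)[OF z])
      finally show ?thesis .
    qed
    ultimately show ?case by blast
  qed
  note min' = this
  obtain p where p: "p > 1" "\<forall>\<^sub>F t in at_top. s * p * \<phi> t \<le> \<phi> (p * t)"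
    using superlinear_scale[OF sup, of s] K(1) unfolding \<phi>_def s_def by auto
  then have p0: "p > 0" by simp
  have "\<forall>\<^sub>F T in at_top. T > 0 \<and> s * p * \<phi> T \<le> \<phi> (p * T) \<and>
     (\<exists>t. p * T \<le> t \<and> t \<le> s * (p * T) \<and> (\<forall>z. norm z = exp t \<longrightarrow> exp (\<phi> (p * T)) \<le> norm (g z)))"
    by (intro eventually_conj eventually_gt_at_top p(2) eventually_compose_filterlim[OF min' scale[OF p0]])
  from eventually_compose_filterlim[OF this filterlim_compose[OF ln_at_top a_at_top]]
  obtain m0 where m0: "\<And>n. n \<ge> m0 \<Longrightarrow> ln (a n) > 0 \<and> s * p * \<phi> (ln (a n)) \<le> \<phi> (p * ln (a n)) \<and>
     (\<exists>t. p * ln (a n) \<le> t \<and> t \<le> s * (p * ln (a n)) \<and> (\<forall>z. norm z = exp t \<longrightarrow> exp (\<phi> (p * ln (a n))) \<le> norm (g z)))"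
    unfolding eventually_sequentially by blast
  then obtain t where t: "\<And>n. n \<ge> m0 \<Longrightarrow> p * ln (a n) \<le> t n \<and> t n \<le> s * (p * ln (a n)) \<and>
     (\<forall>z. norm z = exp (t n) \<longrightarrow> exp (\<phi> (p * ln (a n))) \<le> norm (g z))"
    by metis
  show ?thesis
  proof (rule spiders_web_A_set[of m0 "\<lambda>n. exp (t n)"])
    fix n assume n: "n \<ge> m0"
    have "1 * ln (a n) < p * ln (a n)" using m0[OF n] p(1) by (intro mult_strict_right_mono) auto
    then have "exp (ln (a n)) < exp (t n)" using t[OF n] by (intro exp_less_mono) linarith
    then show "a n < exp (t n)" using a_pos[of n] by simp
    fix z :: complex assume z: "norm z = exp (t n)"
    have "\<phi> (ln (a n)) = ln (a (Suc n))"
      using a_pos[of n] by (simp add: \<phi>_def log_max_modulus_def a_Suc)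
    then have "s * (p * ln (a (Suc n))) \<le> \<phi> (p * ln (a n))" using m0[OF n] by (simp add: mult.assoc)
    moreover have "t (Suc n) \<le> s * (p * ln (a (Suc n)))" using t[of "Suc n"] n by auto
    ultimately have "exp (t (Suc n)) \<le> exp (\<phi> (p * ln (a n)))" by simp
    also have "\<dots> \<le> norm (g z)" using t[OF n] z by blast
    finally show "exp (t (Suc n)) \<le> norm (g z)" .
  qed
qed

end

section \<open>Passage from f to the gap series g\<close>

lemma entire_function_of_transcendental:
  assumes "transcendental_entire g"
  shows "entire_function g"
proof
  show "g holomorphic_on UNIV" using assms by (simp add: transcendental_entire_def)
  show "\<not> g constant_on UNIV"
  proof
    assume "g constant_on UNIV"
    then obtain c where "\<And>z. g z = c" by (auto simp: constant_on_def)
    then have "\<exists>p :: complex poly. \<forall>z. g z = poly p z" by (intro exI[of _ "[:c:]"]) simp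
    then show False using assms by (simp add: transcendental_entire_def)
  qed
qed

text \<open>The order on the complex coefficients is expressed by realness and \<open>Re\<close>,
  the sequence \<open>n\<close> starts at index 1, whence \<open>Suc k\<close> in the series of
  \<open>g\<close>, and transcendence of \<open>f\<close> is contained in
  \<open>log_regular f\<close>.\<close>

theorem theorem6p1:
  fixes f g :: "complex \<Rightarrow> complex" and a :: "nat \<Rightarrow> complex"
    and n :: "nat \<Rightarrow> nat" and N0 :: nat and M \<alpha> :: real
  assumes f_series: "\<And>z. (\<lambda>i. a i * z ^ i) sums f z"
    and f_log_regular: "log_regular f"
    and N0: "N0 \<ge> 1"
    and a_real: "\<And>i. i \<ge> N0 \<Longrightarrow> a i \<in> \<real>"
    and a_decreasing: "\<And>i. i \<ge> N0 \<Longrightarrow> 0 < Re (a (Suc i)) \<and> Re (a (Suc i)) \<le> Re (a i)"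
    and n_strict_mono: "strict_mono_on {1..} n"
    and g_transcendental: "transcendental_entire g"
    and g_series: "\<And>z. (\<lambda>k. a (n (Suc k)) * z ^ n (Suc k)) sums g z"
    and M: "M > 1" and \<alpha>: "\<alpha> > 2"
    and n_ratio: "\<forall>\<^sub>F k in sequentially.
           1 < real (n (Suc k)) / real (n k) \<and> real (n (Suc k)) / real (n k) < M"
    and n_growth: "\<forall>\<^sub>F k in sequentially.
           real (n k) > real k * ln (real k) * (ln (ln (real k))) powr \<alpha>"
  shows "log_regular g \<and>
    (\<forall>R>0. (\<forall>r\<ge>R. max_modulus r g > r) \<longrightarrow> spiders_web (A_set R g))"
proof -
  obtain c where c: "c > 0" "log_regular_with c f" using f_log_regular by (auto simp: log_regular_def)
  then interpret F: entire_function f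
    by (intro entire_function_of_transcendental) (simp add: log_regular_with_def)
  interpret G: entire_function g by (rule entire_function_of_transcendental) fact
  define l where "l k = n (Suc k)" for k
  have l: "strict_mono l"
    using n_strict_mono by (intro strict_monoI_Suc) (auto simp: l_def strict_mono_on_def)
  note g_sums = g_series[folded l_def]
  have a_pos: "0 < Re (a i)" if "i \<ge> N0" for i using a_decreasing[OF that] by linarith
  have a_norm: "norm (a i) = Re (a i)" if "i \<ge> N0" for i
    using a_real[OF that] a_pos[OF that] by (auto simp: complex_is_Real_iff cmod_eq_Re)
  have a_decr: "norm (a j) \<le> norm (a i)" if "N0 \<le> i" "i \<le> j" for i j
    using that(2)
  proof (induction j rule: dec_induct)
    case (step j)
    then have "norm (a (Suc j)) \<le> norm (a j)"
      using a_decreasing[of j] a_norm[of j] a_norm[of "Suc j"] that by auto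
    then show ?case using step by linarith
  qed simp
  have id: "strict_mono (\<lambda>i::nat. i)" by (simp add: strict_mono_def)
  define Sf where "Sf = abs_series a (\<lambda>i. i)"
  define Sg where "Sg = abs_series (\<lambda>k. a (l k)) l"
  have l_ge: "l k \<ge> N0" if "k \<ge> N0" for k
    using strict_mono_imp_increasing[OF l, of k] that by linarith
  have Sf_top: "filterlim Sf at_top at_top"
    unfolding Sf_def by (rule abs_series_at_top[OF f_series id, of N0]) (use a_pos[of N0] N0 in auto)
  have Sg_top: "filterlim Sg at_top at_top"
    unfolding Sg_def
    by (rule abs_series_at_top[OF g_sums l, of N0]) (use a_pos[of "l N0"] l_ge[of N0] N0 in auto)
  have f_le: "\<forall>\<^sub>F r in at_top. Sf r \<le> 2 * max_modulus r f"
    unfolding Sf_def using a_real a_pos F.continuous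
    by (intro abs_series_le_max_modulus[OF f_series id, of N0]) auto
  have g_le: "\<forall>\<^sub>F r in at_top. Sg r \<le> 2 * max_modulus r g"
    unfolding Sg_def using a_real a_pos l_ge G.continuous
    by (intro abs_series_le_max_modulus[OF g_sums l, of N0]) auto
  have Sf_ge: "max_modulus r f \<le> Sf r" and Sg_ge: "max_modulus r g \<le> Sg r" if "r \<ge> 0" for r
    unfolding Sf_def Sg_def
    by (rule max_modulus_le_abs_series[OF f_series id that], rule max_modulus_le_abs_series[OF g_sums l that])
  have sub: "Sg r \<le> Sf r" if "r \<ge> 0" for r
  proof -
    have sum: "summable (\<lambda>i. norm (a i) * r ^ i)" by (rule norm_summable_of_power_series[OF f_series id])
    have "Sg r \<le> (\<Sum>i. norm (a i) * r ^ i)"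
      unfolding Sg_def abs_series_def
    proof (rule suminf_le_const[OF norm_summable_of_power_series[OF g_sums l]])
      fix m
      have "(\<Sum>k<m. norm (a (l k)) * r ^ l k) = (\<Sum>i\<in>l ` {..<m}. norm (a i) * r ^ i)"
        by (rule sum.reindex_cong[of l, symmetric]) (use l in \<open>auto intro: strict_mono_imp_inj_on\<close>)
      also have "\<dots> \<le> (\<Sum>i. norm (a i) * r ^ i)"
        by (rule sum_le_suminf[OF sum]) (use that in auto)
      finally show "(\<Sum>k<m. norm (a (l k)) * r ^ l k) \<le> (\<Sum>i. norm (a i) * r ^ i)" .
    qed
    then show ?thesis by (simp add: Sf_def abs_series_def)
  qed
  obtain k1 where k1: "\<And>k. k \<ge> k1 \<Longrightarrow> 1 < real (n (Suc k)) / real (n k) \<and> real (n (Suc k)) / real (n k) < M"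
    using n_ratio unfolding eventually_sequentially by blast
  define k0 where "k0 = max k1 N0"
  have k0: "l k0 \<ge> N0" using l_ge[of k0] by (simp add: k0_def)
  have "\<exists>C\<ge>1. \<forall>r\<ge>2. abs_series a (\<lambda>i. i) r \<le> C * abs_series (\<lambda>k. a (l k)) l (r powr (2 * M))"
  proof (rule abs_series_le_subseries[OF f_series g_sums l, of M k0])
    fix k assume "k \<ge> k0"
    then have *: "1 < real (l (Suc k)) / real (l k)" "real (l (Suc k)) / real (l k) < M"
      using k1[of "Suc k"] by (auto simp: l_def k0_def)
    \<comment> \<open>Division by 0 yields 0, so a quotient above 1 excludes
      \<open>l k = 0\<close>.\<close>
    then have "real (l k) > 0" by (metis div_by_0 gr0I of_nat_0 of_nat_0_less_iff not_one_less_zero)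
    then show "real (l (Suc k)) \<le> M * real (l k)" using *(2) by (simp add: divide_less_eq)
  next
    show "norm (a j) \<le> norm (a i)" if "l k0 \<le> i" "i \<le> j" for i j
      by (rule a_decr) (use that k0 in auto)
    show "a (l k0) \<noteq> 0" using a_pos[OF k0] by auto
  qed (use M in simp)
  then obtain C where C: "C \<ge> 1" "\<And>r. r \<ge> 2 \<Longrightarrow> Sf r \<le> C * Sg (r powr (2 * M))"
    unfolding Sf_def Sg_def by blast
  define \<phi>f where "\<phi>f = log_max_modulus f"
  define \<phi>g where "\<phi>g = log_max_modulus g"
  have top: "filterlim (log_max_modulus h) at_top at_top"
    if S: "filterlim S at_top at_top" and le: "\<forall>\<^sub>F r in at_top. S r \<le> 2 * max_modulus r h" for S h
  proof -
    have "filterlim (\<lambda>r. max_modulus r h) at_top at_top"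
    proof (rule filterlim_at_top_mono)
      show "filterlim (\<lambda>r. (1 / 2) * S r) at_top at_top"
        by (rule filterlim_tendsto_pos_mult_at_top[OF tendsto_const _ S]) simp
      show "\<forall>\<^sub>F r in at_top. (1 / 2) * S r \<le> max_modulus r h"
        using le by eventually_elim simp
    qed
    from filterlim_compose[OF ln_at_top filterlim_compose[OF this exp_at_top]]
    show ?thesis by (simp add: log_max_modulus_def[abs_def])
  qed
  have f_top: "filterlim \<phi>f at_top at_top" and g_top: "filterlim \<phi>g at_top at_top"
    unfolding \<phi>f_def \<phi>g_def by (rule top[OF Sf_top f_le], rule top[OF Sg_top g_le])
  have "superlinear \<phi>f"
    unfolding \<phi>f_def by (rule F.log_regular_imp_superlinear[OF c(2,1) f_top[unfolded \<phi>f_def]])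
  \<comment> \<open>On the logarithmic scale the power \<open>2 * M\<close> of the radius becomes
    the factor \<open>2 * M\<close>. The constant \<open>2 * C\<close> combines \<open>C\<close>
    with the factor 2 between majorant and maximum modulus.\<close>
  then have sup: "superlinear \<phi>g"
  proof (rule superlinear_transfer[OF _ f_top, of "2 * M" _ "ln (2 * C)"])
    have "filterlim (\<lambda>t. exp (2 * M * t)) at_top at_top"
      using M by (intro filterlim_compose[OF exp_at_top] filterlim_tendsto_pos_mult_at_top[OF tendsto_const])
        (auto intro: filterlim_ident)
    from eventually_compose_filterlim[OF g_le this] filterlim_at_top[THEN iffD1, OF exp_at_top, rule_format, of 2]
    show "\<forall>\<^sub>F t in at_top. \<phi>f t \<le> \<phi>g (2 * M * t) + ln (2 * C)"
    proof eventually_elim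
      case (elim t)
      have Mg: "max_modulus (exp (2 * M * t)) g > 0" by (rule G.M_pos) simp
      have "max_modulus (exp t) f \<le> Sf (exp t)" by (rule Sf_ge) simp
      also have "\<dots> \<le> C * Sg (exp (2 * M * t))"
        using C(2)[OF elim(2)] by (simp add: powr_def)
      also have "\<dots> \<le> C * (2 * max_modulus (exp (2 * M * t)) g)"
        using elim(1) C(1) by (intro mult_left_mono) auto
      finally have "max_modulus (exp t) f \<le> 2 * C * max_modulus (exp (2 * M * t)) g" by simp
      then have "ln (max_modulus (exp t) f) \<le> ln (2 * C * max_modulus (exp (2 * M * t)) g)"
        using F.M_pos[of "exp t"] Mg C(1) by (subst ln_le_cancel_iff) auto
      also have "\<dots> = ln (max_modulus (exp (2 * M * t)) g) + ln (2 * C)"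
        using Mg C(1) by (subst ln_mult) auto
      finally show ?case by (simp add: \<phi>f_def \<phi>g_def log_max_modulus_def)
    qed
    from eventually_compose_filterlim[OF f_le exp_at_top]
    show "\<forall>\<^sub>F t in at_top. \<phi>g t \<le> \<phi>f t + ln (2 * C)"
    proof eventually_elim
      case (elim t)
      have Mf: "max_modulus (exp t) f > 0" by (rule F.M_pos) simp
      have "max_modulus (exp t) g \<le> Sg (exp t)" by (rule Sg_ge) simp
      also have "\<dots> \<le> Sf (exp t)" by (rule sub) simp
      also have "\<dots> \<le> 1 * (2 * max_modulus (exp t) f)" using elim by simp
      also have "\<dots> \<le> C * (2 * max_modulus (exp t) f)" using C(1) Mf by (intro mult_right_mono) auto
      finally have "max_modulus (exp t) g \<le> 2 * C * max_modulus (exp t) f" by simp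
      then have "ln (max_modulus (exp t) g) \<le> ln (2 * C * max_modulus (exp t) f)"
        using G.M_pos[of "exp t"] Mf C(1) by (subst ln_le_cancel_iff) auto
      also have "\<dots> = ln (max_modulus (exp t) f) + ln (2 * C)"
        using Mf C(1) by (subst ln_mult) auto
      finally show ?case by (simp add: \<phi>f_def \<phi>g_def log_max_modulus_def)
    qed
  qed (use M in simp)
  have "log_regular g"
    by (rule G.superlinear_imp_log_regular[OF g_transcendental sup[unfolded \<phi>g_def] g_top[unfolded \<phi>g_def]])
  moreover have "spiders_web (A_set R g)" if R: "R > 0" "\<And>r. r \<ge> R \<Longrightarrow> max_modulus r g > r" for R
  proof -
    interpret escaping g R by unfold_locales (use R in auto)
    have "\<forall>\<^sub>F k in sequentially. real (l k) > real k * ln (real k) * ln (ln (real k)) powr \<alpha>"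
      using n_growth eventually_ge_at_top[of 1]
    proof eventually_elim
      case (elim k)
      \<comment> \<open>The growth condition at index \<open>k\<close> passes to the sequence
        \<open>l\<close>, shifted by one, because \<open>l k\<close> exceeds
        \<open>n k\<close>.\<close>
      then have "n k < n (Suc k)" using n_strict_mono by (auto simp: strict_mono_on_def)
      then show ?case using elim by (simp add: l_def)
    qed
    from gap_series_min_modulus[OF g_sums l \<alpha> this, folded Sg_def, OF filterlim_compose[OF Sg_top exp_at_top]]
    have "\<forall>\<^sub>F T in at_top. \<exists>t. T \<le> t \<and> t \<le> T + 2 \<and> (\<forall>z. norm z = exp t \<longrightarrow> sqrt (max_modulus (exp T) g) \<le> norm (g z))"
    proof eventually_elim
      case (elim T)
      have "sqrt (max_modulus (exp T) g) \<le> sqrt (Sg (exp T))" using Sg_ge[of "exp T"] by simp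
      then show ?case using elim by (meson order_trans)
    qed
    then show ?thesis
      by (rule spiders_web_of_min_modulus[OF sup[unfolded \<phi>g_def] g_top[unfolded \<phi>g_def]])
  qed
  ultimately show ?thesis by blast
qed

end
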